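(* Let $z=Q\tau$ with $\tau=\tau_{\mathfrak a\bar{\mathcal N}}$ and $Q$ a primitive positive definite binary quadratic form of discriminant $-N$. Then $\mathscr R_z$ is a maximal order of the quaternion algebra $\mathscr B_z$ (which is isomorphic to $B$).
   Context: Let $D<-4$ be the discriminant of an imaginary quadratic field $K=\mathbb Q(\sqrt D)$ with $|D|$ prime, $\mathcal O_K$ its ring of integers. Let $N$ be a prime, split in $\mathcal O_K$, such that $-N$ is the discriminant of an imaginary quadratic field. Fix a prime ideal $\mathcal N$ of $\mathcal O_K$ of norm $N$, conjugate $\bar{\mathcal N}$. For a primitive integral ideal $\mathfrak a$ of $\mathcal O_K$ of norm prime to $N$, write $\mathfrak a\bar{\mathcal N}=a_1N\mathbb Z+\frac{-b_1+\sqrt D}{2}\mathbb Z$ and $\tau_{\mathfrak a\bar{\mathcal N}}=\frac{-b_1+\sqrt D}{2a_1N}$. A form $[a,b,c]$ ($b^2-4ac=-N$) is identified with $\begin{pmatrix}2a&b\\ b&2c\end{pmatrix}$. For $z$ in the Siegel upper half space: $L_z=[z,\mathbf 1_2]\mathbb Z^4$, $X_z=\mathbb C^2/L_z$, $H_z=(\operatorname{Im}z)^{-1}$; $\operatorname{End}(X_z)=\{M\in M_2(\mathbb C):ML_z\subseteq L_z\}$, $\operatorname{End}_{\mathbb Q}(X_z)=\operatorname{End}(X_z)\otimes\mathbb Q$; $M^\iota=\operatorname{tr}(M)\mathbf 1_2-M$; $\bar M$ entrywise conjugation; $\mathscr R_z=\{M\in\operatorname{End}(X_z):{}^t\bar MH_z=H_zM^\iota\}$,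 $\mathscr B_z=\{M\in\operatorname{End}_{\mathbb Q}(X_z):{}^t\bar MH_z=H_zM^\iota\}$. $B$ is the quaternion algebra over $\mathbb Q$ ramified exactly at $\infty$ and $|D|$. *)

theory Defs
  imports "HOL-Analysis.Analysis" "HOL-Computational_Algebra.Squarefree"
begin

definition imag_quad_disc :: "int \<Rightarrow> bool" where
  "imag_quad_disc d \<longleftrightarrow> d < 0 \<and>
     ((d mod 4 = 1 \<and> squarefree d) \<or>
      (d mod 4 = 0 \<and> squarefree (d div 4) \<and> ((d div 4) mod 4 = 2 \<or> (d div 4) mod 4 = 3)))"

definition sqrtD :: "int \<Rightarrow> complex" where
  "sqrtD D = Complex 0 (sqrt (- real_of_int D))"

text \<open>Ring of integers of Q(sqrt D), D a fundamental discriminant, as a subset of C.\<close>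
definition OK :: "int \<Rightarrow> complex set" where
  "OK D = {of_int x + of_int y * ((of_int D + sqrtD D) / 2) | x y. True}"

definition is_ideal :: "int \<Rightarrow> complex set \<Rightarrow> bool" where
  "is_ideal D I \<longleftrightarrow> I \<subseteq> OK D \<and> 0 \<in> I \<and> I \<noteq> {0} \<and>
     (\<forall>x\<in>I. \<forall>y\<in>I. x + y \<in> I) \<and> (\<forall>x\<in>I. - x \<in> I) \<and>
     (\<forall>r\<in>OK D. \<forall>x\<in>I. r * x \<in> I)"

definition is_prime_ideal :: "int \<Rightarrow> complex set \<Rightarrow> bool" where
  "is_prime_ideal D P \<longleftrightarrow> is_ideal D P \<and> P \<noteq> OK D \<and>
     (\<forall>x\<in>OK D. \<forall>y\<in>OK D. x * y \<in> P \<longrightarrow> x \<in> P \<or> y \<in> P)"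

definition ideal_prod :: "complex set \<Rightarrow> complex set \<Rightarrow> complex set" where
  "ideal_prod A B = {sum_list (map (\<lambda>(a, b). a * b) ps) | ps. set ps \<subseteq> A \<times> B}"

definition ideal_norm :: "int \<Rightarrow> complex set \<Rightarrow> nat" where
  "ideal_norm D I = card ((\<lambda>x. (\<lambda>y. x + y) ` I) ` OK D)"

definition primitive_ideal :: "int \<Rightarrow> complex set \<Rightarrow> bool" where
  "primitive_ideal D I \<longleftrightarrow> \<not> (\<exists>n::int. n > 1 \<and> I \<subseteq> (\<lambda>x. of_int n * x) ` OK D)"

definition splits :: "int \<Rightarrow> int \<Rightarrow> bool" where
  "splits D p \<longleftrightarrow> (\<exists>P Q. is_prime_ideal D P \<and> is_prime_ideal D Q \<and> P \<noteq> Q \<and>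
     ideal_prod P Q = (\<lambda>x. of_int p * x) ` OK D)"

definition Zlattice2 :: "complex \<Rightarrow> complex \<Rightarrow> complex set" where
  "Zlattice2 w1 w2 = {of_int m * w1 + of_int n * w2 | m n. True}"

definition prim_pos_def_form :: "int \<Rightarrow> int \<Rightarrow> int \<Rightarrow> bool" where
  "prim_pos_def_form a b c \<longleftrightarrow> a > 0 \<and> b^2 - 4*a*c < 0 \<and> gcd a (gcd b c) = 1"

definition form_mat :: "int \<Rightarrow> int \<Rightarrow> int \<Rightarrow> complex^2^2" where
  "form_mat a b c = (\<chi> i j. if i = 1 then (if j = 1 then of_int (2*a) else of_int b)
                              else (if j = 1 then of_int b else of_int (2*c)))"

definition cscale :: "complex \<Rightarrow> complex^2^2 \<Rightarrow> complex^2^2" where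
  "cscale c M = (\<chi> i j. c * M$i$j)"

definition intvecs :: "(complex^2) set" where
  "intvecs = {v. \<forall>i. v$i \<in> \<int>}"

definition Lz :: "complex^2^2 \<Rightarrow> (complex^2) set" where
  "Lz z = {z *v m + n | m n. m \<in> intvecs \<and> n \<in> intvecs}"

definition End_X :: "complex^2^2 \<Rightarrow> (complex^2^2) set" where
  "End_X z = {M. \<forall>v\<in>Lz z. M *v v \<in> Lz z}"

text \<open>End(X_z) tensor Q, realised inside M_2(C) as Q * End(X_z).\<close>
definition EndQ_X :: "complex^2^2 \<Rightarrow> (complex^2^2) set" where
  "EndQ_X z = {cscale (of_rat r) M | r M. M \<in> End_X z}"

definition Hz :: "complex^2^2 \<Rightarrow> complex^2^2" where
  "Hz z = (\<chi> i j. complex_of_real (matrix_inv (\<chi> k l. Im (z$k$l)) $ i $ j))"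

definition ctrans :: "complex^2^2 \<Rightarrow> complex^2^2" where
  "ctrans M = transpose (\<chi> i j. cnj (M$i$j))"

definition iota :: "complex^2^2 \<Rightarrow> complex^2^2" where
  "iota M = cscale (trace M) (mat 1) - M"

definition Rz :: "complex^2^2 \<Rightarrow> (complex^2^2) set" where
  "Rz z = {M \<in> End_X z. ctrans M ** Hz z = Hz z ** iota M}"

definition Bz :: "complex^2^2 \<Rightarrow> (complex^2^2) set" where
  "Bz z = {M \<in> EndQ_X z. ctrans M ** Hz z = Hz z ** iota M}"

definition quat_alg_iso :: "(complex^2^2) set \<Rightarrow> int \<Rightarrow> int \<Rightarrow> bool" where
  "quat_alg_iso S a b \<longleftrightarrow> (\<exists>I J. I ** I = mat (of_int a) \<and> J ** J = mat (of_int b) \<and>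
      I ** J = - (J ** I) \<and>
      S = {cscale q0 (mat 1) + cscale q1 I + cscale q2 J + cscale q3 (I ** J) | q0 q1 q2 q3.
             q0 \<in> \<rat> \<and> q1 \<in> \<rat> \<and> q2 \<in> \<rat> \<and> q3 \<in> \<rat>})"

text \<open>The ternary form a x^2 + b y^2 - w^2 is isotropic over Q_p
  (equivalently, by compactness of Z_p, it has primitive solutions modulo every p^k).\<close>
definition padic_isotropic :: "int \<Rightarrow> int \<Rightarrow> int \<Rightarrow> bool" where
  "padic_isotropic p a b \<longleftrightarrow> (\<forall>k::nat. \<exists>x y w::int. \<not> (p dvd x \<and> p dvd y \<and> p dvd w) \<and>
      (p ^ k) dvd (a * x^2 + b * y^2 - w^2))"

definition ramified_exactly_inf_and :: "int \<Rightarrow> int \<Rightarrow> int \<Rightarrow> bool" where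
  "ramified_exactly_inf_and q a b \<longleftrightarrow> a \<noteq> 0 \<and> b \<noteq> 0 \<and> a < 0 \<and> b < 0 \<and>
      (\<forall>p::int. prime p \<longrightarrow> (\<not> padic_isotropic p a b \<longleftrightarrow> p = q))"

definition is_order :: "(complex^2^2) set \<Rightarrow> (complex^2^2) set \<Rightarrow> bool" where
  "is_order S Ord \<longleftrightarrow> Ord \<subseteq> S \<and> mat 1 \<in> Ord \<and>
     (\<forall>x\<in>Ord. \<forall>y\<in>Ord. x + y \<in> Ord \<and> x - y \<in> Ord \<and> x ** y \<in> Ord) \<and>
     (\<exists>G. finite G \<and> G \<subseteq> Ord \<and>
        Ord = {sum (\<lambda>g. cscale (c g) g) G | c. \<forall>g\<in>G. c g \<in> \<int>}) \<and>
     (\<forall>x\<in>S. \<exists>n::nat. n > 0 \<and> cscale (of_nat n) x \<in> Ord)"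

definition is_maximal_order :: "(complex^2^2) set \<Rightarrow> (complex^2^2) set \<Rightarrow> bool" where
  "is_maximal_order S Ord \<longleftrightarrow> is_order S Ord \<and>
     (\<forall>Ord2. is_order S Ord2 \<and> Ord \<subseteq> Ord2 \<longrightarrow> Ord2 = Ord)"

end

theory Submission
  imports Defs "HOL-Number_Theory.Quadratic_Reciprocity"
begin

text \<open>
  Put \<open>A = ((-b, 2a), (-2c, b))\<close> for the form \<open>Q = [a, b, c]\<close>, so \<open>A\<^sup>2 = -N\<close>. The Hermitian condition on \<open>M\<close>
  says that complex conjugation of \<open>M\<close> is conjugation by \<open>A\<close>, i.e. \<open>M = X + \<surd>D Y\<close> with \<open>X\<close> commuting and \<open>Y\<close>
  anticommuting with \<open>A\<close>. Hence the algebra is \<open>(-N, D)\<close>, whose ramification follows from quadratic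
  reciprocity, as \<open>D\<close> is a square modulo \<open>N\<close>. Since \<open>b1\<^sup>2 - D = 4 a1 N c1\<close> with \<open>a1, b1, c1\<close> without common
  factor, \<open>M\<close> preserves the lattice iff \<open>X + b1 Y\<close> and \<open>2 Y A\<close> are integral. This order has
  discriminant \<open>D\<^sup>2\<close>: an element \<open>M\<close> of a larger order pairs integrally with it under the trace, which
  forces \<open>D M\<close> into it, and since \<open>-N\<close> is a nonresidue modulo \<open>D\<close>, integrality of \<open>det M\<close> removes the
  factor \<open>D\<close>.
\<close>

subsection \<open>Binary forms modulo prime powers\<close>

text \<open>The matrix A arises as Q S with S = ((0, 1), (-1, 0)). Indeed M^iota = S^-1 M^t S, and
  \<open>Hz z\<close> is a real multiple of the inverse of Q, so the Hermitian condition reads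
  conj(M) = (Q S) M (Q S)^-1. The discriminant is never computed: pairing with a few explicit
  elements of the order takes the place of the dual lattice. Two obstacles shape the argument. An
  element of a larger order must be shown to have integral determinant and trace; this follows
  because the determinants of all its powers share one denominator. And the trace conditions are too
  weak at the prime |D|. What closes this gap is that N x^2 + w^2 has no nontrivial zero modulo D,
  and the same fact makes the algebra ramify at |D|: ramification and maximality there have one
  cause.\<close>

lemma not_QuadRes_minus_one:
  fixes p :: int
  assumes "prime p" and "p mod 4 = 3"
  shows "\<not> QuadRes p (-1)"
proof
  assume qr: "QuadRes p (-1)"
  have p2: "p > 2" using assms prime_gt_1_int[of p] by (cases "p = 2") auto
  define n where "n = nat p"
  have "int n = p" "2 < n" using p2 by (simp_all add: n_def)
  moreover have "prime n" unfolding n_def using assms(1) prime_int_nat_transfer by blast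
  ultimately have n: "int n = p" "prime n" "2 < n" by blast+
  have "\<not> [-1 = 0] (mod int n)"
    using p2 n by (auto simp: cong_iff_dvd_diff zdvd_not_zless)
  hence L: "Legendre (-1) (int n) = 1" using qr n by (simp add: Legendre_def)
  have "odd ((n - 1) div 2)" using n assms(2) by presburger
  hence "[1 = -1] (mod int n)"
    using euler_criterion[OF n(2,3), of "-1"] L by simp
  hence "p dvd 2" using n by (simp add: cong_iff_dvd_diff)
  thus False using p2 by (simp add: zdvd_not_zless)
qed

text \<open>If v were a unit modulo p, then u / v would be a square root of -1.\<close>

lemma prime_dvd_sum_squaresD:
  fixes p u v :: int
  assumes "prime p" and "p mod 4 = 3" and "p dvd u\<^sup>2 + v\<^sup>2"
  shows "p dvd v"
proof (rule ccontr)
  assume "\<not> p dvd v"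
  hence "coprime v p" using assms(1) by (simp add: prime_imp_coprime coprime_commute)
  then obtain w where w: "[v * w = 1] (mod p)" by (meson cong_solve_coprime_int)
  have "[u\<^sup>2 = - v\<^sup>2] (mod p)" using assms(3) by (simp add: cong_iff_dvd_diff)
  hence "[u\<^sup>2 * w\<^sup>2 = - (v\<^sup>2) * w\<^sup>2] (mod p)" by (rule cong_mult) simp
  hence "[(u * w)\<^sup>2 = - ((v * w)\<^sup>2)] (mod p)" by (simp add: power_mult_distrib)
  moreover have "[- ((v * w)\<^sup>2) = - (1\<^sup>2)] (mod p)" using w
    by (metis cong_minus_minus_iff cong_pow)
  ultimately have "QuadRes p (-1)" unfolding QuadRes_def using cong_trans by (metis one_power2)
  thus False using not_QuadRes_minus_one assms by blast
qed

text \<open>Modulo N, D is the nonzero square of b1 and -1 is a nonresidue, so -D is a nonresidue.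
  Both primes are 3 modulo 4, so reciprocity flips the symbol and N is a square modulo -D. The form
  thereby becomes a sum of two squares, which has only trivial zeros modulo -D.\<close>

lemma norm_form_anisotropic_mod:
  fixes D N b1 x w :: int
  assumes "D < 0" "prime (- D)" "- D mod 4 = 3" "prime N" "N mod 4 = 3" "\<not> N dvd D"
    and "N dvd b1\<^sup>2 - D" and "D dvd N * x\<^sup>2 + w\<^sup>2"
  shows "D dvd x \<and> D dvd w"
proof -
  define q where "q = - D"
  have q: "prime q" "q mod 4 = 3" "q > 2" "N > 2" "N \<noteq> q"
    using assms prime_gt_1_int[of N] prime_gt_1_int[of "-D"] unfolding q_def
    by (auto, (cases "D = -2"; auto), (cases "N = 2"; auto))
  have "\<not> QuadRes N q"
  proof
    assume "QuadRes N q"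
    then obtain y where "[y\<^sup>2 = q] (mod N)" by (auto simp: QuadRes_def)
    hence "N dvd y\<^sup>2 - q" by (simp add: cong_iff_dvd_diff)
    hence "N dvd (y\<^sup>2 - q) + (b1\<^sup>2 - D)" using assms(7) by (rule dvd_add)
    hence "N dvd y\<^sup>2 + b1\<^sup>2" by (simp add: q_def)
    hence "N dvd b1" using prime_dvd_sum_squaresD assms by blast
    hence "N dvd b1\<^sup>2" by (simp add: power2_eq_square)
    hence "N dvd D" using assms(7) by (metis dvd_diff diff_diff_eq2 add_diff_cancel_left')
    thus False using assms by simp
  qed
  moreover have "\<not> [q = 0] (mod N)" using assms(6) by (simp add: cong_0_iff q_def)
  ultimately have "Legendre q N = -1" by (simp add: Legendre_def)
  moreover have "Legendre N q * Legendre q N = (-1::int) ^ (nat ((N - 1) div 2 * ((q - 1) div 2)))"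
  proof (rule Quadratic_Reciprocity_int)
    show "prime (nat N)" "prime (nat q)"
      using q(1) assms(4) prime_int_nat_transfer by blast+
  qed (rule q)+
  moreover have "(-1::int) ^ (nat ((N - 1) div 2 * ((q - 1) div 2))) = -1"
  proof -
    have "odd ((N - 1) div 2)" "odd ((q - 1) div 2)" using q(2) assms(5) by presburger+
    moreover have "(N - 1) div 2 \<ge> 0" "(q - 1) div 2 \<ge> 0" using q(3,4) by linarith+
    ultimately have "odd (nat ((N - 1) div 2 * ((q - 1) div 2)))"
      by (metis even_mult_iff even_nat_iff mult_nonneg_nonneg)
    thus ?thesis by (rule uminus_power_if[THEN trans, OF if_not_P[THEN trans]]) simp
  qed
  ultimately have "Legendre N q * (- 1) = - 1" by metis
  hence "Legendre N q = 1" by linarith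
  hence "QuadRes q N" by (auto simp: Legendre_def split: if_splits)
  then obtain y where "[y\<^sup>2 = N] (mod q)" by (auto simp: QuadRes_def)
  hence y: "q dvd y\<^sup>2 - N" by (simp add: cong_iff_dvd_diff)
  have "q dvd N * x\<^sup>2 + w\<^sup>2" using assms(8) by (simp add: q_def)
  hence "q dvd (N * x\<^sup>2 + w\<^sup>2) + (y\<^sup>2 - N) * x\<^sup>2" using y by simp
  also have "(N * x\<^sup>2 + w\<^sup>2) + (y\<^sup>2 - N) * x\<^sup>2 = (y * x)\<^sup>2 + w\<^sup>2"
    by (simp add: algebra_simps power2_eq_square)
  finally have s: "q dvd (y * x)\<^sup>2 + w\<^sup>2" .
  have w: "q dvd w" using prime_dvd_sum_squaresD[OF q(1,2) s] .
  hence "q dvd w\<^sup>2" by (simp add: power2_eq_square)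
  hence "q dvd N * x\<^sup>2" using \<open>q dvd N * x\<^sup>2 + w\<^sup>2\<close> by (simp add: dvd_add_left_iff)
  moreover have "\<not> q dvd N" using q(1,5) assms(4) primes_dvd_imp_eq by blast
  ultimately have "q dvd x" using q(1) by (meson prime_dvd_mult_iff prime_dvd_power)
  thus ?thesis using w by (simp add: q_def)
qed

text \<open>Newton iteration: with t inverse to 2 v modulo p, replacing v by v - t m p^k cancels the
  error m p^k modulo p^(k+1).\<close>

lemma odd_prime_square_lift:
  fixes p u w :: int
  assumes "prime p" "p \<noteq> 2" "\<not> p dvd w" "p dvd w\<^sup>2 - u"
  shows "\<exists>v. \<not> p dvd v \<and> p ^ k dvd v\<^sup>2 - u"
proof (induction k)
  case 0
  show ?case using assms by auto
next
  case (Suc k)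
  \<comment> \<open>The quadratic error term carries p^(2k), which is divisible by p^(k+1) only for
    positive k; the passage from exponent 0 to 1 uses w itself.\<close>
  show ?case
  proof (cases "k = 0")
    case True
    thus ?thesis using assms by auto
  next
    case False
    from Suc obtain v m where v: "\<not> p dvd v" "v\<^sup>2 - u = p ^ k * m" by (metis dvdE)
    have "\<not> p dvd 2" using assms(1,2) primes_dvd_imp_eq two_is_prime_nat
      by (metis prime_int_numeral_eq primes_dvd_imp_eq two_is_prime_nat)
    hence "\<not> p dvd 2 * v" using v(1) assms(1) by (simp add: prime_dvd_mult_iff)
    hence "coprime (2 * v) p" using assms(1) by (metis prime_imp_coprime coprime_commute)
    then obtain t where "[2 * v * t = 1] (mod p)" by (meson cong_solve_coprime_int)
    then obtain r where r: "2 * v * t = 1 + p * r" 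
      by (metis cong_iff_lin cong_sym)
    define v' where "v' = v - t * m * p ^ k"
    obtain j where j: "k = Suc j" using False by (cases k) auto
    have "v'\<^sup>2 - u = (v\<^sup>2 - u) - (2 * v * t) * m * p ^ k + t\<^sup>2 * m\<^sup>2 * (p ^ k * p ^ k)"
      by (simp add: v'_def power2_eq_square algebra_simps)
    also have "\<dots> = p * p ^ k * (- r * m + t\<^sup>2 * m\<^sup>2 * p ^ j)"
      unfolding v(2) r by (simp add: j algebra_simps)
    finally have "p ^ Suc k dvd v'\<^sup>2 - u" by simp
    moreover have "\<not> p dvd v'"
    proof
      assume "p dvd v'"
      moreover have "p dvd t * m * p ^ k" by (simp add: j)
      ultimately have "p dvd v' + t * m * p ^ k" by (rule dvd_add)
      thus False using v(1) by (simp add: v'_def)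
    qed
    ultimately show ?thesis by blast
  qed
qed

text \<open>The derivative 2 v is even, so the correction sits one exponent lower: adding 2^(j+2) to
  an odd v changes its square by an odd multiple of 2^(j+3). The induction starts at 8, where every
  odd square is 1.\<close>

lemma two_power_square_lift:
  fixes u :: int
  assumes "u mod 8 = 1"
  shows "\<exists>v. odd v \<and> 2 ^ k dvd v\<^sup>2 - u"
proof -
  have "\<exists>v. odd v \<and> 2 ^ (j + 3) dvd v\<^sup>2 - u" for j
  proof (induction j)
    case 0
    have "8 dvd 1 - u" using assms by presburger
    thus ?case by (intro exI[of _ 1]) simp
  next
    case (Suc j)
    then obtain v m where v: "odd v" "v\<^sup>2 - u = 2 ^ (j + 3) * m" by (auto elim: dvdE)
    show ?case
    proof (cases "even m")
      case True
      then obtain r where "m = 2 * r" by (elim evenE)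
      hence "v\<^sup>2 - u = 2 ^ (Suc j + 3) * r" using v by (simp add: power_add)
      thus ?thesis using v(1) by (metis dvd_triv_left)
    next
      case False
      define v' where "v' = v + 2 ^ (j + 2)"
      have "v'\<^sup>2 - u = (v\<^sup>2 - u) + v * (2 * 2 ^ (j + 2)) + 2 ^ (j + 2) * 2 ^ (j + 2)"
        by (simp add: v'_def power2_eq_square algebra_simps)
      also have "\<dots> = 2 ^ (j + 3) * (m + v + 2 * 2 ^ j)"
        unfolding v(2) by (simp add: algebra_simps power_add)
      finally have e: "v'\<^sup>2 - u = 2 ^ (j + 3) * (m + v + 2 * 2 ^ j)" .
      have "even (m + v + 2 * 2 ^ j)" using False v(1) by simp
      then obtain r where "m + v + 2 * 2 ^ j = 2 * r" by (elim evenE)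
      hence "v'\<^sup>2 - u = 2 ^ (Suc j + 3) * r" using e by (simp add: power_add)
      hence "2 ^ (Suc j + 3) dvd v'\<^sup>2 - u" by simp
      moreover have "odd v'" using v(1) by (simp add: v'_def)
      ultimately show ?thesis by blast
    qed
  qed
  then obtain v where v: "odd v" "2 ^ (k + 3) dvd v\<^sup>2 - u" by blast
  have "(2::int) ^ k dvd 2 ^ (k + 3)" by (simp add: le_imp_power_dvd)
  thus ?thesis using v dvd_trans by blast
qed

section \<open>Zeros of ternary forms modulo prime powers\<close>

lemma square_mod_inj_on:
  fixes p :: int
  assumes "prime p" "p > 2" "\<not> p dvd c"
  shows "inj_on (\<lambda>x. (d + c * x\<^sup>2) mod p) {0..(p - 1) div 2}"
proof (rule inj_onI)
  fix x y assume xy: "x \<in> {0..(p - 1) div 2}" "y \<in> {0..(p - 1) div 2}"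
    "(d + c * x\<^sup>2) mod p = (d + c * y\<^sup>2) mod p"
  hence "p dvd (d + c * x\<^sup>2) - (d + c * y\<^sup>2)" by (simp add: mod_eq_dvd_iff)
  also have "(d + c * x\<^sup>2) - (d + c * y\<^sup>2) = c * ((x - y) * (x + y))"
    by (simp add: power2_eq_square algebra_simps)
  finally have "p dvd x - y \<or> p dvd x + y" using assms by (simp add: prime_dvd_mult_iff)
  moreover have "\<bar>x - y\<bar> < p" "\<bar>x + y\<bar> < p" using xy(1,2) assms(2) by auto
  ultimately have "x - y = 0 \<or> x + y = 0" by (metis dvd_imp_le_int linorder_not_less abs_of_pos assms(2) less_trans zero_less_numeral)
  thus "x = y" using xy(1,2) by auto
qed

text \<open>Both n x^2 + d and w^2 take (p + 1) / 2 values modulo p, and two such sets of residues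
  must meet.\<close>

lemma binary_form_represents_mod:
  fixes p n d :: int
  assumes "prime p" "p > 2" "\<not> p dvd n"
  shows "\<exists>x w. p dvd n * x\<^sup>2 + d - w\<^sup>2"
proof -
  let ?S = "{0..(p - 1) div 2}"
  let ?A = "(\<lambda>x. (d + n * x\<^sup>2) mod p) ` ?S" and ?B = "(\<lambda>x. (0 + 1 * x\<^sup>2) mod p) ` ?S"
  have odd: "odd p" using assms prime_odd_int by auto
  have c: "int (card ?S) * 2 = p + 1" using odd assms(2) by auto
  have "card ?A = card ?S"
    by (rule card_image, rule square_mod_inj_on) (use assms in auto)
  moreover have "card ?B = card ?S"
    by (rule card_image, rule square_mod_inj_on) (use assms in \<open>auto simp: zdvd_not_zless\<close>)
  moreover have "?A \<inter> ?B \<noteq> {}"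
  proof
    assume "?A \<inter> ?B = {}"
    hence "card (?A \<union> ?B) = card ?A + card ?B" by (intro card_Un_disjoint) auto
    moreover have "card (?A \<union> ?B) \<le> card {0..<p}" by (rule card_mono) (use assms in auto)
    moreover have "int (card {0..<p}) = p" using assms by simp
    ultimately show False using c \<open>card ?A = card ?S\<close> \<open>card ?B = card ?S\<close> by linarith
  qed
  then obtain x w where "(d + n * x\<^sup>2) mod p = (0 + 1 * w\<^sup>2) mod p" by blast
  hence "p dvd (d + n * x\<^sup>2) - w\<^sup>2" by (simp add: mod_eq_dvd_iff)
  thus ?thesis by (auto simp: algebra_simps)
qed

text \<open>Only w is varied: x and y stay fixed while w is lifted to a square root of m x^2 + n
  y^2, which is why w has to be a unit.\<close>

lemma padic_isotropicI_odd:
  fixes p m n x y w :: int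
  assumes "prime p" "p \<noteq> 2" "\<not> p dvd w" "p dvd m * x\<^sup>2 + n * y\<^sup>2 - w\<^sup>2"
  shows "padic_isotropic p m n"
  unfolding padic_isotropic_def
proof
  fix k :: nat
  have "p dvd w\<^sup>2 - (m * x\<^sup>2 + n * y\<^sup>2)" using assms(4) by (simp add: dvd_diff_commute)
  then obtain v where "\<not> p dvd v" "p ^ k dvd v\<^sup>2 - (m * x\<^sup>2 + n * y\<^sup>2)"
    using odd_prime_square_lift[OF assms(1-3)] by blast
  hence "\<not> (p dvd x \<and> p dvd y \<and> p dvd v)" "p ^ k dvd m * x\<^sup>2 + n * y\<^sup>2 - v\<^sup>2"
    by (simp_all add: dvd_diff_commute)
  thus "\<exists>x y w. \<not> (p dvd x \<and> p dvd y \<and> p dvd w) \<and> p ^ k dvd m * x\<^sup>2 + n * y\<^sup>2 - w\<^sup>2" by blast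
qed

lemma padic_isotropicI_two:
  fixes m n x y :: int
  assumes "(m * x\<^sup>2 + n * y\<^sup>2) mod 8 = 1"
  shows "padic_isotropic 2 m n"
  unfolding padic_isotropic_def
proof
  fix k :: nat
  obtain v where "odd v" "2 ^ k dvd v\<^sup>2 - (m * x\<^sup>2 + n * y\<^sup>2)"
    using two_power_square_lift[OF assms] by blast
  hence "\<not> (2 dvd x \<and> 2 dvd y \<and> 2 dvd v)" "2 ^ k dvd m * x\<^sup>2 + n * y\<^sup>2 - v\<^sup>2"
    by (simp_all add: dvd_diff_commute)
  thus "\<exists>x y w. \<not> (2 dvd x \<and> 2 dvd y \<and> 2 dvd w) \<and> 2 ^ k dvd m * x\<^sup>2 + n * y\<^sup>2 - w\<^sup>2" by blast
qed

text \<open>The pigeonhole zero with y = 1 lifts when its w is a unit; otherwise it is traded for a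
  zero whose w is one.\<close>

lemma padic_isotropic_units:
  fixes p m n :: int
  assumes "prime p" "p > 2" "\<not> p dvd m" "\<not> p dvd n"
  shows "padic_isotropic p m n"
proof -
  obtain x w where xw: "p dvd m * x\<^sup>2 + n - w\<^sup>2"
    using binary_form_represents_mod[OF assms(1-3)] by blast
  show ?thesis
  proof (cases "p dvd w")
    case False
    show ?thesis by (rule padic_isotropicI_odd[of p w m x n 1]) (use False xw assms in auto)
  next
    case True
    \<comment> \<open>Here \<open>(x, 1)\<close> is isotropic for \<open>m x\<^sup>2 + n y\<^sup>2\<close> modulo \<open>p\<close>, and an isotropic binary form
      represents every residue, for instance the square \<open>(2 n)\<^sup>2\<close>.\<close>
    hence "p dvd m * x\<^sup>2 + n"
      using xw by (metis diff_add_cancel dvd_add dvd_mult2 power2_eq_square)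
    hence "p dvd (m * x\<^sup>2 + n) * (1 - n)\<^sup>2" by simp
    also have "(m * x\<^sup>2 + n) * (1 - n)\<^sup>2 = m * (x * (1 - n))\<^sup>2 + n * (1 + n)\<^sup>2 - (2 * n)\<^sup>2"
      by (simp add: power2_eq_square algebra_simps)
    finally have "p dvd m * (x * (1 - n))\<^sup>2 + n * (1 + n)\<^sup>2 - (2 * n)\<^sup>2" .
    moreover have "\<not> p dvd 2 * n" using assms by (auto simp: prime_dvd_mult_iff zdvd_not_zless)
    ultimately show ?thesis using padic_isotropicI_odd assms by (metis less_irrefl)
  qed
qed

lemma ramified_exactly_inf_and_disc:
  fixes D N b1 :: int
  assumes "D < 0" "prime (- D)" "- D mod 4 = 3" "prime N" "N mod 4 = 3" "\<not> N dvd D"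
    and "N dvd b1\<^sup>2 - D"
  shows "ramified_exactly_inf_and (- D) (- N) D"
proof -
  have N0: "N > 0" using assms(4) prime_gt_0_int by simp
  have "padic_isotropic p (- N) D" if p: "prime p" "p \<noteq> - D" for p
  proof -
    have pD: "\<not> p dvd D" using p assms(2) primes_dvd_imp_eq by (metis dvd_minus_iff)
    consider "p = 2" | "p = N" "p \<noteq> 2" | "p \<noteq> 2" "p \<noteq> N" by blast
    thus ?thesis
    proof cases
      case 1
      \<comment> \<open>Both -N and D are 1 or 5 modulo 8. If both are 5, then -N + 4 D is 25, hence
        1 modulo 8.\<close>
      have "(- N) mod 8 = 1 \<or> D mod 8 = 1 \<or> (- N + D * 4) mod 8 = 1"
        using assms(3,5) by presburger
      hence "(- N * 1\<^sup>2 + D * 0\<^sup>2) mod 8 = 1 \<or> (- N * 0\<^sup>2 + D * 1\<^sup>2) mod 8 = 1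
          \<or> (- N * 1\<^sup>2 + D * 2\<^sup>2) mod 8 = 1" by simp
      thus ?thesis using padic_isotropicI_two 1 by blast
    next
      case 2
      \<comment> \<open>At N the zero is (0, 1, b1).\<close>
      have "\<not> N dvd b1"
        using assms(6,7) by (metis dvd_diff diff_diff_eq2 add_diff_cancel_left' dvd_mult2 power2_eq_square)
      moreover have "N dvd - N * 0\<^sup>2 + D * 1\<^sup>2 - b1\<^sup>2" using assms(7) by (simp add: dvd_diff_commute)
      ultimately show ?thesis using padic_isotropicI_odd 2 p by blast
    next
      case 3
      have "\<not> p dvd - N" using p 3 assms(4) primes_dvd_imp_eq by (metis dvd_minus_iff)
      moreover have "p > 2" using 3 p prime_gt_1_int[of p] by simp
      ultimately show ?thesis using padic_isotropic_units p pD by blast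
    qed
  qed
  moreover have "\<not> padic_isotropic (- D) (- N) D"
  proof
    assume "padic_isotropic (- D) (- N) D"
    \<comment> \<open>Exponent 2 suffices: modulo D the form forces D to divide x and w, and modulo
      D^2 the surviving term D y^2 then forces D to divide y.\<close>
    then obtain x y w where xyw: "\<not> (- D dvd x \<and> - D dvd y \<and> - D dvd w)"
      "(- D) ^ 2 dvd - N * x\<^sup>2 + D * y\<^sup>2 - w\<^sup>2"
      unfolding padic_isotropic_def by blast
    have d2: "D * D dvd - N * x\<^sup>2 + D * y\<^sup>2 - w\<^sup>2" using xyw(2) by (simp add: power2_eq_square)
    then obtain m where m: "- N * x\<^sup>2 + D * y\<^sup>2 - w\<^sup>2 = D * D * m" by (elim dvdE)
    have "N * x\<^sup>2 + w\<^sup>2 = D * (y\<^sup>2 - D * m)" using m by (simp add: algebra_simps)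
    hence "D dvd N * x\<^sup>2 + w\<^sup>2" by simp
    hence xw: "D dvd x" "D dvd w" using norm_form_anisotropic_mod assms by blast+
    then obtain x' w' where "x = D * x'" "w = D * w'" by (elim dvdE)
    hence "D * y\<^sup>2 = D * (D * (m + N * x'\<^sup>2 + w'\<^sup>2))"
      using m by (simp add: power2_eq_square algebra_simps)
    hence "y\<^sup>2 = D * (m + N * x'\<^sup>2 + w'\<^sup>2)" using assms(1) by simp
    hence "- D dvd y\<^sup>2" by simp
    hence "- D dvd y" using assms(2) prime_dvd_power by blast
    thus False using xyw(1) xw by simp
  qed
  ultimately show ?thesis using assms N0 unfolding ramified_exactly_inf_and_def by auto
qed

subsection \<open>Integrality in coordinates\<close>

text \<open>Splits an integrality proof into an algebraic identity and an application of closure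
  rules; nearly every integrality argument below has this shape.\<close>

lemma Ints_eqI: "x = y \<Longrightarrow> y \<in> \<int> \<Longrightarrow> x \<in> \<int>"
  by simp

lemmas Ints_intros = Ints_add Ints_diff Ints_mult Ints_power Ints_of_int Ints_numeral Ints_minus

lemma Ints_of_coprime_multiples:
  fixes x :: real and k l :: int
  assumes "coprime k l" "of_int k * x \<in> \<int>" "of_int l * x \<in> \<int>"
  shows "x \<in> \<int>"
proof -
  obtain u v where "u * k + v * l = 1" using assms(1) by (metis bezout_int coprime_iff_gcd_eq_1)
  hence "real_of_int u * of_int k + of_int v * of_int l = 1" by (metis of_int_1 of_int_add of_int_mult)
  hence "x = of_int u * (of_int k * x) + of_int v * (of_int l * x)"
    by (metis distrib_right mult.assoc mult_1)
  also have "\<dots> \<in> \<int>" using assms by (intro assms(2,3) Ints_intros)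
  finally show ?thesis .
qed

text \<open>\<open>b1_disc\<close> says that tau is a root of a1 N X^2 + b1 X + c1. Quadratic
  reciprocity reaches the matrix computations only through \<open>aniso\<close>.\<close>

locale form_pair =
  fixes D N a b c a1 b1 c1 :: int
  assumes D_neg: "D < 0" and prime_D: "prime (- D)" and coprime_D: "coprime D (2 * N)"
    and N_pos: "N > 0" and N_odd: "odd N"
    and a_pos: "a > 0" and form_disc: "N = 4 * a * c - b\<^sup>2"
    and a1_pos: "a1 > 0" and b1_disc: "b1\<^sup>2 - D = 4 * a1 * N * c1"
    and aniso: "\<And>x w. D dvd N * x\<^sup>2 + w\<^sup>2 \<Longrightarrow> D dvd x \<and> D dvd w"
begin

lemma b_odd: "odd b"
proof -
  have "odd (4 * a * c - b\<^sup>2)" using N_odd form_disc by simp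
  thus ?thesis by simp
qed

abbreviation (input) "rD \<equiv> real_of_int D"
abbreviation (input) "rN \<equiv> real_of_int N"
abbreviation (input) "ra \<equiv> real_of_int a"
abbreviation (input) "rb \<equiv> real_of_int b"
abbreviation (input) "rc \<equiv> real_of_int c"
abbreviation (input) "ra1 \<equiv> real_of_int a1"
abbreviation (input) "rb1 \<equiv> real_of_int b1"
abbreviation (input) "rc1 \<equiv> real_of_int c1"

lemma real_form_disc: "rN = 4 * ra * rc - rb\<^sup>2"
  using arg_cong[OF form_disc, of real_of_int] by simp

lemma real_b1_disc: "rD = rb1\<^sup>2 - 4 * ra1 * rN * rc1"
  using arg_cong[OF b1_disc, of real_of_int] by simp

lemma pos_facts: "ra > 0" "rN > 0" "ra1 > 0" "rD < 0"
  using a_pos N_pos a1_pos D_neg by simp_all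

text \<open>Write \<open>A = ((-b, 2a), (-2c, b))\<close>, so that \<open>A\<^sup>2 = -N\<close>. The matrix \<open>Y = ((y1, y2), (y3, -y1))\<close>
  anticommutes with \<open>A\<close> iff \<open>a y3 = b y1 + c y2\<close>. For \<open>X = x0 + x1 A\<close>, the integrality conditions below say
  that the entries of \<open>X + b1 Y\<close> and of \<open>2 Y A\<close> are integers.\<close>

definition anticomm :: "real \<Rightarrow> real \<Rightarrow> real \<Rightarrow> bool" where
  "anticomm y1 y2 y3 \<longleftrightarrow> ra * y3 = rb * y1 + rc * y2"

definition order_coords :: "real \<Rightarrow> real \<Rightarrow> real \<Rightarrow> real \<Rightarrow> real \<Rightarrow> bool" where
  "order_coords x0 x1 y1 y2 y3 \<longleftrightarrow> anticomm y1 y2 y3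
     \<and> x0 - rb * x1 + rb1 * y1 \<in> \<int>
     \<and> 2 * ra * x1 + rb1 * y2 \<in> \<int>
     \<and> - 2 * rc * x1 + rb1 * y3 \<in> \<int>
     \<and> x0 + rb * x1 - rb1 * y1 \<in> \<int>
     \<and> 2 * (rb * y1 + 2 * rc * y2) \<in> \<int>
     \<and> 2 * (2 * ra * y1 + rb * y2) \<in> \<int>
     \<and> 2 * (2 * rc * y1 - rb * y3) \<in> \<int>"

text \<open>Multiplying by 4 a completes the square and makes \<open>aniso\<close> applicable. The
  prime does not divide a, since otherwise (1, b) would be a zero of N x^2 + w^2 modulo D.\<close>

lemma D_dvd_form:
  assumes "D dvd a * t1\<^sup>2 - b * t1 * t2 + c * t2\<^sup>2"
  shows "D dvd t1 \<and> D dvd t2"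
proof -
  have "D dvd 4 * a * (a * t1\<^sup>2 - b * t1 * t2 + c * t2\<^sup>2)" using assms by simp
  also have "4 * a * (a * t1\<^sup>2 - b * t1 * t2 + c * t2\<^sup>2) = N * t2\<^sup>2 + (2 * a * t1 - b * t2)\<^sup>2"
    unfolding form_disc by (simp add: power2_eq_square algebra_simps)
  finally have t: "D dvd t2" "D dvd 2 * a * t1 - b * t2" using aniso by blast+
  have "D dvd 2 * a * t1" using t by (metis dvd_add dvd_mult diff_add_cancel)
  moreover have "\<not> D dvd a"
  proof
    assume "D dvd a"
    hence "D dvd N * 1\<^sup>2 + b\<^sup>2" by (simp add: form_disc)
    hence "D dvd 1" using aniso by blast
    thus False using prime_D by (metis dvd_minus_iff not_prime_unit minus_dvd_iff)
  qed
  moreover have "\<not> D dvd 2"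
  proof
    assume "D dvd 2"
    hence "D dvd 2 * N" by simp
    hence "D dvd 1" using coprime_D by (metis coprime_absorb_left)
    thus False using prime_D by (metis dvd_minus_iff not_prime_unit minus_dvd_iff)
  qed
  ultimately show ?thesis using t prime_D by (metis minus_dvd_iff prime_dvd_mult_iff)
qed

text \<open>The hypotheses are the trace pairings with the test elements together with the
  determinant. The pairings bound the denominators of 2 Y A by D, and the determinant removes D.
  After that X + b1 Y becomes integral on multiplication by D and also by 2 N, which are
  coprime.\<close>

lemma order_coords_of_integral:
  fixes x0 x1 y1 y2 y3 :: real
  assumes y: "anticomm y1 y2 y3" and u: "2 * x0 \<in> \<int>" and v: "x0 - rN * x1 \<in> \<int>"
    and e11: "rb1 * (x0 - rb * x1) + rD * y1 \<in> \<int>"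
    and e12: "2 * ra * rb1 * x1 + rD * y2 \<in> \<int>"
    and e21: "- 2 * rc * rb1 * x1 + rD * y3 \<in> \<int>"
    and nrm: "x0\<^sup>2 + rN * x1\<^sup>2 - rD * (y1\<^sup>2 + y2 * y3) \<in> \<int>"
  shows "order_coords x0 x1 y1 y2 y3"
proof -
  \<comment> \<open>These are the entries of Y A = ((-e1, e2), (e3, e1)). Multiplying by -A gives
    back N Y, which is \<open>Ny\<close>; \<open>ae3\<close> says that Y A anticommutes with A as
    well.\<close>
  define e1 e2 e3 :: real where "e1 = rb * y1 + 2 * rc * y2" and "e2 = 2 * ra * y1 + rb * y2"
    and "e3 = 2 * rc * y1 - rb * y3"
  have y': "ra * y3 = rb * y1 + rc * y2" using y by (simp add: anticomm_def)
  have Ny: "rN * y1 = 2 * rc * e2 - rb * e1" "rN * y2 = 2 * ra * e1 - rb * e2" "rN * y3 = rb * e3 + 2 * rc * e1"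
    using y' unfolding e1_def e2_def e3_def real_form_disc by Groebner_Basis.algebra+
  have ae3: "ra * e3 = rc * e2 - rb * e1" using y' unfolding e1_def e2_def e3_def by Groebner_Basis.algebra
  have e22: "rb1 * (x0 + rb * x1) - rD * y1 \<in> \<int>"
  proof -
    have "rb1 * (x0 + rb * x1) - rD * y1 = rb1 * (2 * x0) - (rb1 * (x0 - rb * x1) + rD * y1)"
      by (simp add: algebra_simps)
    thus ?thesis by (rule Ints_eqI) (intro e11 u Ints_intros)
  qed
  have x1Z: "2 * rN * x1 \<in> \<int>"
  proof -
    have "2 * rN * x1 = 2 * x0 - 2 * (x0 - rN * x1)" by simp
    thus ?thesis by (rule Ints_eqI) (intro u v Ints_intros)
  qed
  have NX11: "rN * (x0 - rb * x1) \<in> \<int>" and NX22: "rN * (x0 + rb * x1) \<in> \<int>"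
  proof -
    \<comment> \<open>Only 2 x0 and x0 - N x1 are known to be integral, so N - b must be halved; N
      and b are both odd.\<close>
    have "even (N - b)" using N_odd b_odd by simp
    then obtain k where "N - b = 2 * k" by (elim evenE)
    hence k: "rN = rb + 2 * real_of_int k" by linarith
    have "rN * (x0 - rb * x1) = real_of_int k * (2 * x0) + rb * (x0 - rN * x1)" using k by Groebner_Basis.algebra
    thus 1: "rN * (x0 - rb * x1) \<in> \<int>" by (rule Ints_eqI) (intro u v Ints_intros)
    have "rN * (x0 + rb * x1) = rN * (2 * x0) - rN * (x0 - rb * x1)" by Groebner_Basis.algebra
    thus "rN * (x0 + rb * x1) \<in> \<int>" by (rule Ints_eqI) (intro u 1 Ints_intros)
  qed
  have NX12: "rN * (2 * ra * x1) \<in> \<int>" and NX21: "rN * (- 2 * rc * x1) \<in> \<int>"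
  proof -
    have "rN * (2 * ra * x1) = ra * (2 * rN * x1)" by simp
    thus "rN * (2 * ra * x1) \<in> \<int>" by (rule Ints_eqI) (intro x1Z Ints_intros)
    have "rN * (- 2 * rc * x1) = - (rc * (2 * rN * x1))" by simp
    thus "rN * (- 2 * rc * x1) \<in> \<int>" by (rule Ints_eqI) (intro x1Z Ints_intros)
  qed
  have te1: "2 * rD * e1 \<in> \<int>"
  proof -
    have "2 * rD * e1 = 2 * (ra * (- 2 * rc * rb1 * x1 + rD * y3) + rc * (2 * ra * rb1 * x1 + rD * y2))"
      using y' unfolding e1_def by Groebner_Basis.algebra
    thus ?thesis by (rule Ints_eqI) (intro e12 e21 Ints_intros)
  qed
  have te2: "2 * rD * e2 \<in> \<int>"
  proof -
    have "2 * rD * e2 = 2 * (ra * ((rb1 * (x0 - rb * x1) + rD * y1) - (rb1 * (x0 + rb * x1) - rD * y1))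
        + rb * (2 * ra * rb1 * x1 + rD * y2))"
      unfolding e2_def by Groebner_Basis.algebra
    thus ?thesis by (rule Ints_eqI) (intro e11 e22 e12 Ints_intros)
  qed
  have te3: "2 * rD * e3 \<in> \<int>"
  proof -
    have "2 * rD * e3 = 2 * (rc * ((rb1 * (x0 - rb * x1) + rD * y1) - (rb1 * (x0 + rb * x1) - rD * y1))
        - rb * (- 2 * rc * rb1 * x1 + rD * y3))"
      unfolding e3_def by Groebner_Basis.algebra
    thus ?thesis by (rule Ints_eqI) (intro e11 e22 e21 Ints_intros)
  qed
  obtain t1 t2 t3 :: int where t: "2 * rD * e1 = t1" "2 * rD * e2 = t2" "2 * rD * e3 = t3"
    using te1 te2 te3 by (metis Ints_cases)
  \<comment> \<open>This is 4 N times the determinant, rearranged: det (Y A) = N det Y turns the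
    part in Y into e1^2 + e2 e3.\<close>
  have "4 * rD * (e1\<^sup>2 + e2 * e3) \<in> \<int>"
  proof -
    have "4 * rD * (e1\<^sup>2 + e2 * e3) = rN * (2 * x0)\<^sup>2 + (2 * rN * x1)\<^sup>2
        - 4 * rN * (x0\<^sup>2 + rN * x1\<^sup>2 - rD * (y1\<^sup>2 + y2 * y3))"
      using y' unfolding e1_def e2_def e3_def real_form_disc by Groebner_Basis.algebra
    thus ?thesis by (rule Ints_eqI) (intro u x1Z nrm Ints_intros)
  qed
  then obtain m :: int where m: "4 * rD * (e1\<^sup>2 + e2 * e3) = m" by (metis Ints_cases)
  have at3: "a * t3 = c * t2 - b * t1"
  proof -
    have "real_of_int (a * t3) = of_int (c * t2 - b * t1)"
      using ae3 by (simp flip: t) Groebner_Basis.algebra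
    thus ?thesis by (simp only: of_int_eq_iff)
  qed
  have "real_of_int (t1\<^sup>2 + t2 * t3) = of_int (D * m)"
    by (simp flip: t m) Groebner_Basis.algebra
  hence "t1\<^sup>2 + t2 * t3 = D * m" by (simp only: of_int_eq_iff)
  \<comment> \<open>Eliminating t3 leaves a binary form of discriminant -N, which is anisotropic
    modulo D.\<close>
  hence "a * t1\<^sup>2 - b * t1 * t2 + c * t2\<^sup>2 = D * (a * m)" using at3 by Groebner_Basis.algebra
  hence tt: "D dvd t1" "D dvd t2" using D_dvd_form by (metis dvd_triv_left)+
  have "D dvd c * t2 - b * t1" using tt by simp
  hence "D dvd a * t3" by (simp add: at3)
  moreover have "\<not> D dvd a"
    using D_dvd_form[of 1 0] prime_D by (auto simp: prime_int_iff)
  ultimately have "D dvd t3" using prime_D by (metis minus_dvd_iff prime_dvd_mult_iff)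
  have quot: "2 * e \<in> \<int>" if et: "2 * rD * e = of_int t" "D dvd t" for e :: real and t
  proof -
    obtain k where "t = D * k" using et(2) by (elim dvdE)
    hence "rD * (2 * e) = rD * real_of_int k" using et(1) by simp
    hence "2 * e = real_of_int k" using D_neg by (metis mult_cancel_left of_int_eq_0_iff less_irrefl)
    thus ?thesis by simp
  qed
  have eZ: "2 * e1 \<in> \<int>" "2 * e2 \<in> \<int>" "2 * e3 \<in> \<int>"
    using quot[OF t(1) tt(1)] quot[OF t(2) tt(2)] quot[OF t(3) \<open>D dvd t3\<close>] by auto
  have yZ: "2 * rN * y1 \<in> \<int>" "2 * rN * y2 \<in> \<int>" "2 * rN * y3 \<in> \<int>"
  proof -
    have "2 * rN * y1 = 2 * rc * (2 * e2) - rb * (2 * e1)" using Ny(1) by simp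
    thus "2 * rN * y1 \<in> \<int>" by (rule Ints_eqI) (intro eZ Ints_intros)
    have "2 * rN * y2 = 2 * ra * (2 * e1) - rb * (2 * e2)" using Ny(2) by simp
    thus "2 * rN * y2 \<in> \<int>" by (rule Ints_eqI) (intro eZ Ints_intros)
    have "2 * rN * y3 = rb * (2 * e3) + 2 * rc * (2 * e1)" using Ny(3) by simp
    thus "2 * rN * y3 \<in> \<int>" by (rule Ints_eqI) (intro eZ Ints_intros)
  qed
  have WZ: "x + rb1 * y \<in> \<int>" if "rN * x \<in> \<int>" "2 * rN * y \<in> \<int>" "rb1 * x + rD * y \<in> \<int>" for x y :: real
  proof (rule Ints_of_coprime_multiples[OF coprime_D])
    have "rD * (x + rb1 * y) = rb1 * (rb1 * x + rD * y) - 4 * ra1 * rc1 * (rN * x)"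
      unfolding real_b1_disc by Groebner_Basis.algebra
    thus "rD * (x + rb1 * y) \<in> \<int>" by (rule Ints_eqI) (intro that Ints_intros)
    have "real_of_int (2 * N) * (x + rb1 * y) = 2 * (rN * x) + rb1 * (2 * rN * y)" by (simp add: algebra_simps)
    thus "real_of_int (2 * N) * (x + rb1 * y) \<in> \<int>" by (rule Ints_eqI) (intro that Ints_intros)
  qed
  have "x0 - rb * x1 + rb1 * y1 \<in> \<int>" by (rule WZ[OF NX11 yZ(1) e11])
  moreover have "2 * ra * x1 + rb1 * y2 \<in> \<int>"
    by (rule WZ[OF NX12 yZ(2)]) (use e12 in \<open>simp add: algebra_simps\<close>)
  moreover have "- 2 * rc * x1 + rb1 * y3 \<in> \<int>"
    by (rule WZ[OF NX21 yZ(3)]) (use e21 in \<open>simp add: algebra_simps\<close>)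
  moreover have "x0 + rb * x1 - rb1 * y1 \<in> \<int>"
    using WZ[OF NX22, of "- y1"] yZ(1) e22 by simp
  ultimately show ?thesis using y eZ by (simp only: order_coords_def e1_def e2_def e3_def simp_thms)
qed

end

subsection \<open>Endomorphisms in coordinates\<close>

definition mat22 :: "'a \<Rightarrow> 'a \<Rightarrow> 'a \<Rightarrow> 'a \<Rightarrow> 'a^2^2" where
  "mat22 p q r t = (\<chi> i j. if i = 1 then (if j = 1 then p else q) else (if j = 1 then r else t))"

lemma mat22_nth [simp]:
  "mat22 p q r t $ 1 $ 1 = p" "mat22 p q r t $ 1 $ 2 = q" "mat22 p q r t $ 2 $ 1 = r" "mat22 p q r t $ 2 $ 2 = t"
  by (simp_all add: mat22_def)

lemma mat2_eq_iff:
  "M = M' \<longleftrightarrow> M$1$1 = M'$1$1 \<and> M$1$2 = M'$1$2 \<and> M$2$1 = M'$2$1 \<and> M$2$2 = M'$2$2"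
  for M M' :: "'a^2^2"
  by (auto simp: vec_eq_iff forall_2)

lemma matrix_mult_2_nth:
  "(A ** B) $ i $ j = A $ i $ 1 * B $ 1 $ j + A $ i $ 2 * B $ 2 $ j" for A B :: "'a::semiring_1^2^2"
  by (simp add: matrix_matrix_mult_def sum_2)

lemma matrix_vector_2_nth:
  "(A *v v) $ i = A $ i $ 1 * v $ 1 + A $ i $ 2 * v $ 2" for A :: "'a::semiring_1^2^2"
  by (simp add: matrix_vector_mult_def sum_2)

lemma form_mat_eq: "form_mat a b c = mat22 (2 * of_int a) (of_int b) (of_int b) (2 * of_int c)"
  by (simp add: mat2_eq_iff form_mat_def)

lemma cscale_nth [simp]: "cscale k M $ i $ j = k * M $ i $ j"
  by (simp add: cscale_def)

lemma ctrans_nth [simp]: "ctrans M $ i $ j = cnj (M $ j $ i)"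
  by (simp add: ctrans_def transpose_def)

text \<open>For 2 by 2 matrices \<open>iota\<close> is the adjugate, so it reverses
  products.\<close>

lemma iota_nth [simp]:
  "iota M $ 1 $ 1 = M $ 2 $ 2" "iota M $ 1 $ 2 = - M $ 1 $ 2"
  "iota M $ 2 $ 1 = - M $ 2 $ 1" "iota M $ 2 $ 2 = M $ 1 $ 1"
  by (simp_all add: iota_def trace_def sum_2 mat_def)

lemma iota_mult: "iota (A ** B) = iota B ** iota A"
  by (simp add: mat2_eq_iff matrix_mult_2_nth)

lemma ctrans_mult: "ctrans (A ** B) = ctrans B ** ctrans A"
  by (simp add: mat2_eq_iff matrix_mult_2_nth)

lemma matrix_inv_eqI:
  fixes A B :: "'a::semiring_1^'n^'n"
  assumes "A ** B = mat 1" "B ** A = mat 1"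
  shows "matrix_inv A = B"
proof -
  have "A ** matrix_inv A = mat 1 \<and> matrix_inv A ** A = mat 1"
    unfolding matrix_inv_def by (rule someI[of _ B]) (use assms in simp)
  thus ?thesis using assms by (metis matrix_mul_assoc matrix_mul_lid matrix_mul_rid)
qed

context form_pair
begin

definition s where "s = sqrt (- rD)"

lemma s_pos: "s > 0" and s_sq: "s * s = - rD"
  using D_neg by (simp_all add: s_def)

definition tau where "tau = Complex (- rb1 / (2 * ra1 * rN)) (s / (2 * ra1 * rN))"

definition zz where "zz = cscale tau (form_mat a b c)"

text \<open>This is \<open>X + \<surd>D Y\<close>, with \<open>X\<close> and \<open>Y\<close> as above.\<close>

definition mk :: "real \<Rightarrow> real \<Rightarrow> real \<Rightarrow> real \<Rightarrow> real \<Rightarrow> complex^2^2" where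
  "mk x0 x1 y1 y2 y3 =
     mat22 (Complex (x0 - rb * x1) (s * y1)) (Complex (2 * ra * x1) (s * y2))
         (Complex (- 2 * rc * x1) (s * y3)) (Complex (x0 + rb * x1) (- s * y1))"

lemma tau_eq: "tau = (- of_int b1 + sqrtD D) / (2 * of_int a1 * of_int N)"
proof -
  have "(2 * of_int a1 * of_int N :: complex) = complex_of_real (2 * ra1 * rN)" by simp
  moreover have "- of_int b1 + sqrtD D = Complex (- rb1) s"
    by (simp add: sqrtD_def s_def complex_eq_iff)
  ultimately show ?thesis by (simp add: tau_def complex_eq_iff Re_divide_of_real Im_divide_of_real
        del: of_real_mult)
qed

text \<open>The imaginary part of \<open>zz\<close> is a positive multiple of the form matrix, so
  its inverse is a multiple of the adjugate. The scalar cancels from the Hermitian condition, hence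
  only its being nonzero is recorded.\<close>

lemma Hz_zz:
  obtains k where "k \<noteq> 0" "Hz zz = mat22 (of_real (k * (2 * rc))) (of_real (- k * rb)) (of_real (- k * rb)) (of_real (k * (2 * ra)))"
proof -
  define t where "t = Im tau"
  have t: "t > 0" using s_pos pos_facts by (simp add: t_def tau_def)
  define k where "k = 1 / (t * rN)"
  have k: "k \<noteq> 0" "t * k * rN = 1" using t pos_facts by (simp_all add: k_def)
  have im: "(\<chi> i j. Im (zz $ i $ j)) = mat22 (t * (2 * ra)) (t * rb) (t * rb) (t * (2 * rc))"
    by (simp add: mat2_eq_iff zz_def form_mat_eq t_def)
  have "matrix_inv (mat22 (t * (2 * ra)) (t * rb) (t * rb) (t * (2 * rc)))
      = mat22 (k * (2 * rc)) (- k * rb) (- k * rb) (k * (2 * ra))"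
    using k(2) unfolding real_form_disc
    by (intro matrix_inv_eqI; simp add: mat2_eq_iff matrix_mult_2_nth mat_def algebra_simps power2_eq_square)
  hence "Hz zz = mat22 (of_real (k * (2 * rc))) (of_real (- k * rb)) (of_real (- k * rb)) (of_real (k * (2 * ra)))"
    unfolding Hz_def im by (simp add: mat2_eq_iff)
  thus ?thesis using that k by blast
qed

lemma hermitian_mk:
  assumes "anticomm y1 y2 y3"
  shows "ctrans (mk x0 x1 y1 y2 y3) ** Hz zz = Hz zz ** iota (mk x0 x1 y1 y2 y3)"
proof -
  obtain k where H: "Hz zz = mat22 (of_real (k * (2 * rc))) (of_real (- k * rb)) (of_real (- k * rb)) (of_real (k * (2 * ra)))"
    using Hz_zz by blast
  have y: "ra * y3 = rb * y1 + rc * y2" using assms by (simp add: anticomm_def)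
  have yk: "k * (y3 * (ra * (s * 2))) = k * (y1 * (rb * (s * 2))) + k * (y2 * (rc * (s * 2)))"
    using y by Groebner_Basis.algebra
  show ?thesis unfolding H
    by (simp add: mat2_eq_iff matrix_mult_2_nth mk_def complex_eq_iff algebra_simps) (simp add: yk)
qed

text \<open>Real and imaginary parts separate: the real parts of M lie in the span of 1 and A, while
  the imaginary parts have trace zero and satisfy \<open>anticomm\<close>.\<close>

lemma hermitian_imp_mk:
  assumes "ctrans M ** Hz zz = Hz zz ** iota M"
  obtains x0 x1 y1 y2 y3 where "anticomm y1 y2 y3" "M = mk x0 x1 y1 y2 y3"
proof -
  obtain k where k: "k \<noteq> 0" and H: "Hz zz = mat22 (of_real (k * (2 * rc))) (of_real (- k * rb)) (of_real (- k * rb)) (of_real (k * (2 * ra)))"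
    using Hz_zz by blast
  define p q r t where "p = M$1$1" and "q = M$1$2" and "r = M$2$1" and "t = M$2$2"
  have M: "M = mat22 p q r t" by (simp add: mat2_eq_iff p_def q_def r_def t_def)
  have 1: "k * (2 * ra * Re t - 2 * rb * Re q - 2 * ra * Re p) = 0"
     and 2: "k * (2 * ra * Re r + 2 * rc * Re q) = 0"
     and 3: "k * (2 * ra) * (Im t + Im p) = 0"
     and 4: "k * (2 * rb * Im p - 2 * ra * Im r + 2 * rc * Im q) = 0"
    using assms unfolding H M
    by (simp_all add: mat2_eq_iff matrix_mult_2_nth complex_eq_iff algebra_simps)
  have a0: "ra \<noteq> 0" using pos_facts by simp
  have e: "ra * Re t = rb * Re q + ra * Re p" "ra * Re r = - rc * Re q" "Im t = - Im p"
    "ra * Im r = rb * Im p + rc * Im q"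
    using 1 2 3 4 k a0 by simp_all
  have s0: "s \<noteq> 0" using s_pos by simp
  have "anticomm (Im p / s) (Im q / s) (Im r / s)" using e(4) s0 unfolding anticomm_def by (simp add: field_simps)
  moreover have "M = mk ((Re p + Re t) / 2) (Re q / (2 * ra)) (Im p / s) (Im q / s) (Im r / s)"
    using e s0 a0 unfolding M mk_def by (simp add: mat2_eq_iff complex_eq_iff field_simps)
  ultimately show ?thesis using that by blast
qed

section \<open>Lattice membership and endomorphisms\<close>

definition inL :: "complex \<Rightarrow> complex \<Rightarrow> bool" where
  "inL v w \<longleftrightarrow> (\<exists>m1 m2 n1 n2 :: int.
      v = tau * (2 * of_int a * of_int m1 + of_int b * of_int m2) + of_int n1 \<and>
      w = tau * (of_int b * of_int m1 + 2 * of_int c * of_int m2) + of_int n2)"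

lemma Lz_zz: "v \<in> Lz zz \<longleftrightarrow> inL (v $ 1) (v $ 2)"
proof
  assume "v \<in> Lz zz"
  then obtain m n where mn: "m \<in> intvecs" "n \<in> intvecs" "v = zz *v m + n" by (auto simp: Lz_def)
  obtain m1 m2 n1 n2 where "m $ 1 = of_int m1" "m $ 2 = of_int m2" "n $ 1 = of_int n1" "n $ 2 = of_int n2"
    using mn by (metis (mono_tags) intvecs_def mem_Collect_eq Ints_cases)
  thus "inL (v $ 1) (v $ 2)" unfolding inL_def
    by (intro exI[of _ m1] exI[of _ m2] exI[of _ n1] exI[of _ n2])
      (simp add: mn matrix_vector_2_nth zz_def form_mat_eq algebra_simps)
next
  assume "inL (v $ 1) (v $ 2)"
  then obtain m1 m2 n1 n2 :: int where
    e: "v $ 1 = tau * (2 * of_int a * of_int m1 + of_int b * of_int m2) + of_int n1"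
      "v $ 2 = tau * (of_int b * of_int m1 + 2 * of_int c * of_int m2) + of_int n2"
    by (auto simp: inL_def)
  have "v = zz *v (\<chi> i. if i = 1 then of_int m1 else of_int m2) + (\<chi> i. if i = 1 then of_int n1 else of_int n2)"
    by (simp add: vec_eq_iff forall_2 e matrix_vector_2_nth zz_def form_mat_eq algebra_simps)
  moreover have "(\<chi> i. if i = 1 then of_int k else of_int l) \<in> intvecs" for k l
    by (simp add: intvecs_def)
  ultimately show "v \<in> Lz zz" unfolding Lz_def by blast
qed

lemma inL_add: "inL v w \<Longrightarrow> inL v' w' \<Longrightarrow> inL (v + v') (w + w')"
proof -
  assume "inL v w" "inL v' w'"
  then obtain m1 m2 n1 n2 m1' m2' n1' n2' :: int where
    "v = tau * (2 * of_int a * of_int m1 + of_int b * of_int m2) + of_int n1"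
    "w = tau * (of_int b * of_int m1 + 2 * of_int c * of_int m2) + of_int n2"
    "v' = tau * (2 * of_int a * of_int m1' + of_int b * of_int m2') + of_int n1'"
    "w' = tau * (of_int b * of_int m1' + 2 * of_int c * of_int m2') + of_int n2'"
    unfolding inL_def by blast
  thus ?thesis unfolding inL_def
    by (intro exI[of _ "m1 + m1'"] exI[of _ "m2 + m2'"] exI[of _ "n1 + n1'"] exI[of _ "n2 + n2'"])
      (simp add: algebra_simps)
qed

lemma inL_scale: "inL v w \<Longrightarrow> inL (of_int k * v) (of_int k * w)"
proof -
  assume "inL v w"
  then obtain m1 m2 n1 n2 :: int where
    "v = tau * (2 * of_int a * of_int m1 + of_int b * of_int m2) + of_int n1"
    "w = tau * (of_int b * of_int m1 + 2 * of_int c * of_int m2) + of_int n2"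
    unfolding inL_def by blast
  thus ?thesis unfolding inL_def
    by (intro exI[of _ "k * m1"] exI[of _ "k * m2"] exI[of _ "k * n1"] exI[of _ "k * n2"])
      (simp add: algebra_simps)
qed

text \<open>The four conjuncts are the images of the four lattice generators: the two unit vectors
  and the two columns of \<open>zz\<close>.\<close>

lemma End_X_zz:
  "mat22 p q r t \<in> End_X zz \<longleftrightarrow> inL p r \<and> inL q t
     \<and> inL (tau * (2 * of_int a * p + of_int b * q)) (tau * (2 * of_int a * r + of_int b * t))
     \<and> inL (tau * (of_int b * p + 2 * of_int c * q)) (tau * (of_int b * r + 2 * of_int c * t))"
  (is "?M \<in> _ \<longleftrightarrow> ?R")
proof
  assume M: "?M \<in> End_X zz"
  have E: "inL (p * v + q * w) (r * v + t * w)" if "inL v w" for v w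
  proof -
    define u :: "complex^2" where "u = (\<chi> i. if i = 1 then v else w)"
    have "u \<in> Lz zz" using that by (simp add: Lz_zz u_def)
    hence "?M *v u \<in> Lz zz" using M by (auto simp: End_X_def)
    thus ?thesis by (simp add: Lz_zz matrix_vector_2_nth u_def)
  qed
  have "inL 1 0" unfolding inL_def
    by (rule exI[of _ 0], rule exI[of _ 0], rule exI[of _ 1], rule exI[of _ 0]) simp
  moreover have "inL 0 1" unfolding inL_def
    by (rule exI[of _ 0], rule exI[of _ 0], rule exI[of _ 0], rule exI[of _ 1]) simp
  moreover have "inL (tau * (2 * of_int a)) (tau * of_int b)" unfolding inL_def
    by (rule exI[of _ 1], rule exI[of _ 0], rule exI[of _ 0], rule exI[of _ 0]) simp
  moreover have "inL (tau * of_int b) (tau * (2 * of_int c))" unfolding inL_def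
    by (rule exI[of _ 0], rule exI[of _ 1], rule exI[of _ 0], rule exI[of _ 0]) simp
  ultimately have "inL (p * 1 + q * 0) (r * 1 + t * 0)" "inL (p * 0 + q * 1) (r * 0 + t * 1)"
    "inL (p * (tau * (2 * of_int a)) + q * (tau * of_int b)) (r * (tau * (2 * of_int a)) + t * (tau * of_int b))"
    "inL (p * (tau * of_int b) + q * (tau * (2 * of_int c))) (r * (tau * of_int b) + t * (tau * (2 * of_int c)))"
    using E by blast+
  thus ?R by (simp add: algebra_simps)
next
  assume R: ?R
  show "?M \<in> End_X zz" unfolding End_X_def
  proof (clarify)
    fix v assume "v \<in> Lz zz"
    then obtain m1 m2 n1 n2 :: int where
      v: "v $ 1 = tau * (2 * of_int a * of_int m1 + of_int b * of_int m2) + of_int n1"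
        "v $ 2 = tau * (of_int b * of_int m1 + 2 * of_int c * of_int m2) + of_int n2"
      by (auto simp: inL_def Lz_zz)
    have "inL (of_int n1 * p + of_int n2 * q
          + of_int m1 * (tau * (2 * of_int a * p + of_int b * q))
          + of_int m2 * (tau * (of_int b * p + 2 * of_int c * q)))
        (of_int n1 * r + of_int n2 * t
          + of_int m1 * (tau * (2 * of_int a * r + of_int b * t))
          + of_int m2 * (tau * (of_int b * r + 2 * of_int c * t)))"
      using R by (intro inL_add inL_scale) auto
    thus "?M *v v \<in> Lz zz" unfolding Lz_zz matrix_vector_2_nth v mat22_nth by (simp add: algebra_simps)
  qed
qed

text \<open>The imaginary part determines the coefficient of tau, the real part then the integer.
  Solving for the lattice coordinates inverts the form matrix, whose determinant N cancels the N in
  the denominator of tau.\<close>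

lemma inL_real:
  fixes p y p' y' :: real
  shows "inL (Complex p (s * y)) (Complex p' (s * y')) \<longleftrightarrow> p + rb1 * y \<in> \<int> \<and> p' + rb1 * y' \<in> \<int>
    \<and> 2 * ra1 * (2 * rc * y - rb * y') \<in> \<int> \<and> 2 * ra1 * (2 * ra * y' - rb * y) \<in> \<int>" (is "?L \<longleftrightarrow> ?R")
proof -
  have d: "2 * ra1 * rN \<noteq> 0" "s \<noteq> 0" "rN \<noteq> 0" using pos_facts s_pos by simp_all
  have key: "Complex p (s * y) = tau * (of_real m) + of_int n \<longleftrightarrow> 2 * ra1 * rN * y = m \<and> p + rb1 * y = of_int n"
    for p y m and n :: int
  proof -
    have "Complex p (s * y) = tau * (of_real m) + of_int n \<longleftrightarrow>
      p = - rb1 / (2 * ra1 * rN) * m + of_int n \<and> s * y = s / (2 * ra1 * rN) * m"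
      by (simp add: complex_eq_iff tau_def)
    also have "s * y = s / (2 * ra1 * rN) * m \<longleftrightarrow> 2 * ra1 * rN * y = m"
      using d by (simp add: field_simps)
    also have "p = - rb1 / (2 * ra1 * rN) * m + of_int n \<and> 2 * ra1 * rN * y = m \<longleftrightarrow>
       2 * ra1 * rN * y = m \<and> p + rb1 * y = of_int n"
    proof -
      have "- rb1 / (2 * ra1 * rN) * (2 * ra1 * rN * y) = - rb1 * y" using d(1) by simp
      thus ?thesis by auto
    qed
    finally show ?thesis .
  qed
  have "?L \<longleftrightarrow> (\<exists>m1 m2 n1 n2 :: int.
      Complex p (s * y) = tau * of_real (2 * ra * of_int m1 + rb * of_int m2) + of_int n1 \<and>
      Complex p' (s * y') = tau * of_real (rb * of_int m1 + 2 * rc * of_int m2) + of_int n2)"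
    unfolding inL_def by simp
  also have "\<dots> \<longleftrightarrow> (\<exists>m1 m2 n1 n2 :: int.
     (2 * ra1 * rN * y = 2 * ra * of_int m1 + rb * of_int m2 \<and> p + rb1 * y = of_int n1) \<and>
     (2 * ra1 * rN * y' = rb * of_int m1 + 2 * rc * of_int m2 \<and> p' + rb1 * y' = of_int n2))"
    unfolding key ..
  also have "\<dots> \<longleftrightarrow> (\<exists>m1 m2 n1 n2 :: int. p + rb1 * y = of_int n1 \<and> p' + rb1 * y' = of_int n2 \<and>
      2 * ra1 * (2 * rc * y - rb * y') = of_int m1 \<and> 2 * ra1 * (2 * ra * y' - rb * y) = of_int m2)"
  proof -
    have "2 * ra1 * rN * y = 2 * ra * m1 + rb * m2 \<and> 2 * ra1 * rN * y' = rb * m1 + 2 * rc * m2 \<longleftrightarrow>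
      2 * ra1 * (2 * rc * y - rb * y') = m1 \<and> 2 * ra1 * (2 * ra * y' - rb * y) = m2" (is "?A \<longleftrightarrow> ?B") for m1 m2 :: real
    proof
      assume ?A
      hence "rN * (2 * ra1 * (2 * rc * y - rb * y')) = rN * m1"
        "rN * (2 * ra1 * (2 * ra * y' - rb * y)) = rN * m2"
        using real_form_disc by Groebner_Basis.algebra+
      thus ?B using d(3) by (metis mult_left_cancel)
    next
      assume ?B
      hence m: "m1 = 2 * ra1 * (2 * rc * y - rb * y')" "m2 = 2 * ra1 * (2 * ra * y' - rb * y)" by auto
      show ?A unfolding m real_form_disc by (simp add: algebra_simps power2_eq_square)
    qed
    thus ?thesis by blast
  qed
  also have "\<dots> \<longleftrightarrow> ?R" by (auto simp: Ints_def)
  finally show ?thesis .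
qed

lemma tau_mult: "tau * Complex p (s * y) =
   Complex ((- rb1 * p + rD * y) / (2 * ra1 * rN)) (s * ((p - rb1 * y) / (2 * ra1 * rN)))"
proof -
  have "s * (s * y) = - rD * y" using s_sq by (metis mult.assoc)
  thus ?thesis using pos_facts
    by (simp add: tau_def complex_eq_iff field_simps)
qed

text \<open>The square of a common divisor of a1, b1 and c1 divides the prime -D.\<close>

lemma coprime_a1_c1_b1: "coprime (gcd a1 c1) b1"
proof -
  define g where "g = gcd (gcd a1 c1) b1"
  obtain u v w where e: "a1 = g * u" "c1 = g * v" "b1 = g * w"
    by (metis g_def dvdE gcd_dvd1 gcd_dvd2 dvd_trans)
  have "- D = g * (g * (4 * u * N * v - w\<^sup>2))"
    using b1_disc unfolding e by (simp add: power2_eq_square algebra_simps)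
  moreover have "irreducible (- D)" using prime_D by (rule prime_elem_imp_irreducible[OF prime_imp_prime_elem])
  ultimately have "is_unit g \<or> is_unit (g * (4 * u * N * v - w\<^sup>2))" by (rule irreducibleD[rotated])
  hence "is_unit g" by (metis is_unit_mult_iff)
  thus ?thesis by (simp add: g_def coprime_iff_gcd_eq_1)
qed

text \<open>The unit vectors yield integrality of 2 a1 Y A and of X + b1 Y; the columns of
  \<open>zz\<close> yield that of 2 c1 Y A and again of X + b1 Y. Since b1 (2 Y A) is then integral
  too, coprimality of a1, b1 and c1 leaves 2 Y A itself.\<close>

lemma mk_in_End_X:
  assumes "anticomm y1 y2 y3"
  shows "mk x0 x1 y1 y2 y3 \<in> End_X zz \<longleftrightarrow> order_coords x0 x1 y1 y2 y3"
proof -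
  define e1 e2 e3 :: real where "e1 = rb * y1 + 2 * rc * y2" and "e2 = 2 * ra * y1 + rb * y2"
    and "e3 = 2 * rc * y1 - rb * y3"
  have y: "ra * y3 = rb * y1 + rc * y2" using assms by (simp add: anticomm_def)
  have d: "ra1 \<noteq> 0" "rN \<noteq> 0" using pos_facts by simp_all
  \<comment> \<open>Multiplication by tau is what brings in c1: by b1^2 - D = 4 a1 N c1 the integer
    part becomes -2 c1 y.\<close>
  have T: "inL (tau * Complex p (s * y)) (tau * Complex p' (s * y')) \<longleftrightarrow>
      2 * rc1 * y \<in> \<int> \<and> 2 * rc1 * y' \<in> \<int> \<and>
      (2 * rc * (p - rb1 * y) - rb * (p' - rb1 * y')) / rN \<in> \<int> \<and>
      (2 * ra * (p' - rb1 * y') - rb * (p - rb1 * y)) / rN \<in> \<int>" for p y p' y'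
  proof -
    have h: "(- rb1 * p + rD * y) / (2 * ra1 * rN) + rb1 * ((p - rb1 * y) / (2 * ra1 * rN)) = - (2 * rc1 * y)" for p y
      using d unfolding real_b1_disc by (simp add: field_simps power2_eq_square)
    have h2: "2 * ra1 * (2 * rc * ((p - rb1 * y) / (2 * ra1 * rN)) - rb * ((p' - rb1 * y') / (2 * ra1 * rN)))
       = (2 * rc * (p - rb1 * y) - rb * (p' - rb1 * y')) / rN"
      "2 * ra1 * (2 * ra * ((p' - rb1 * y') / (2 * ra1 * rN)) - rb * ((p - rb1 * y) / (2 * ra1 * rN)))
       = (2 * ra * (p' - rb1 * y') - rb * (p - rb1 * y)) / rN"
      using d by (simp_all add: field_simps)
    show ?thesis unfolding tau_mult inL_real h h2 by simp
  qed
  define w11 w12 w21 w22 where "w11 = x0 - rb * x1 + rb1 * y1" and "w12 = 2 * ra * x1 + rb1 * y2"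
    and "w21 = - 2 * rc * x1 + rb1 * y3" and "w22 = x0 + rb * x1 - rb1 * y1"
  have e1': "2 * ra * y3 - rb * y1 = e1" unfolding e1_def using y by Groebner_Basis.algebra
  have c1: "inL (Complex (x0 - rb * x1) (s * y1)) (Complex (- 2 * rc * x1) (s * y3)) \<longleftrightarrow>
    w11 \<in> \<int> \<and> w21 \<in> \<int> \<and> 2 * ra1 * e3 \<in> \<int> \<and> 2 * ra1 * e1 \<in> \<int>"
    unfolding inL_real e1' by (simp add: w11_def w21_def e3_def)
  have c2: "inL (Complex (2 * ra * x1) (s * y2)) (Complex (x0 + rb * x1) (- s * y1)) \<longleftrightarrow>
    w12 \<in> \<int> \<and> w22 \<in> \<int> \<and> 2 * ra1 * e1 \<in> \<int> \<and> 2 * ra1 * e2 \<in> \<int>"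
  proof -
    have "2 * ra1 * (2 * ra * (- y1) - rb * y2) = - (2 * ra1 * e2)"
      "2 * ra1 * (2 * rc * y2 - rb * (- y1)) = 2 * ra1 * e1" by (simp_all add: e1_def e2_def algebra_simps)
    moreover have "- s * y1 = s * (- y1)" "x0 + rb * x1 + rb1 * (- y1) = w22" by (simp_all add: w22_def)
    ultimately show ?thesis unfolding w12_def by (simp only: inL_real minus_in_Ints_iff)
  qed
  have quo: "x / rN = z \<longleftrightarrow> x = rN * z" for x z :: real using d by (simp add: field_simps)
  have c3: "inL (tau * (2 * of_int a * Complex (x0 - rb * x1) (s * y1) + of_int b * Complex (2 * ra * x1) (s * y2)))
     (tau * (2 * of_int a * Complex (- 2 * rc * x1) (s * y3) + of_int b * Complex (x0 + rb * x1) (- s * y1))) \<longleftrightarrow>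
     2 * rc1 * e2 \<in> \<int> \<and> 2 * rc1 * e1 \<in> \<int> \<and> w22 \<in> \<int> \<and> w12 \<in> \<int>"
  proof -
    have 1: "2 * of_int a * Complex (x0 - rb * x1) (s * y1) + of_int b * Complex (2 * ra * x1) (s * y2)
      = Complex (2 * ra * x0) (s * e2)"
      by (simp add: complex_eq_iff e2_def algebra_simps)
    have 2: "2 * of_int a * Complex (- 2 * rc * x1) (s * y3) + of_int b * Complex (x0 + rb * x1) (- s * y1)
      = Complex (rb * x0 - rN * x1) (s * e1)"
      by (simp add: complex_eq_iff e1'[symmetric] real_form_disc algebra_simps power2_eq_square)
    have 3: "(2 * rc * (2 * ra * x0 - rb1 * e2) - rb * (rb * x0 - rN * x1 - rb1 * e1)) / rN = w22"
      unfolding quo unfolding w22_def e1_def e2_def real_form_disc by Groebner_Basis.algebra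
    have 4: "(2 * ra * (rb * x0 - rN * x1 - rb1 * e1) - rb * (2 * ra * x0 - rb1 * e2)) / rN = - w12"
      unfolding quo unfolding w12_def e1_def e2_def real_form_disc by Groebner_Basis.algebra
    show ?thesis unfolding 1 2 T 3 4 by simp
  qed
  have c4: "inL (tau * (of_int b * Complex (x0 - rb * x1) (s * y1) + 2 * of_int c * Complex (2 * ra * x1) (s * y2)))
     (tau * (of_int b * Complex (- 2 * rc * x1) (s * y3) + 2 * of_int c * Complex (x0 + rb * x1) (- s * y1))) \<longleftrightarrow>
     2 * rc1 * e1 \<in> \<int> \<and> 2 * rc1 * e3 \<in> \<int> \<and> w21 \<in> \<int> \<and> w11 \<in> \<int>"
  proof -
    have 1: "of_int b * Complex (x0 - rb * x1) (s * y1) + 2 * of_int c * Complex (2 * ra * x1) (s * y2)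
      = Complex (rb * x0 + rN * x1) (s * e1)"
      by (simp add: complex_eq_iff e1_def real_form_disc algebra_simps power2_eq_square)
    have 2: "of_int b * Complex (- 2 * rc * x1) (s * y3) + 2 * of_int c * Complex (x0 + rb * x1) (- s * y1)
      = Complex (2 * rc * x0) (s * (- e3))"
      by (simp add: complex_eq_iff e3_def algebra_simps)
    have 3: "(2 * rc * (rb * x0 + rN * x1 - rb1 * e1) - rb * (2 * rc * x0 - rb1 * (- e3))) / rN = - w21"
      unfolding quo unfolding w21_def e1_def e3_def real_form_disc using y by Groebner_Basis.algebra
    have 4: "(2 * ra * (2 * rc * x0 - rb1 * (- e3)) - rb * (rb * x0 + rN * x1 - rb1 * e1)) / rN = w11"
      unfolding quo unfolding w11_def e1_def e3_def real_form_disc using y by Groebner_Basis.algebra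
    show ?thesis unfolding 1 2 T 3 4 by simp
  qed
  have order_coords_iff: "order_coords x0 x1 y1 y2 y3 \<longleftrightarrow> w11 \<in> \<int> \<and> w12 \<in> \<int> \<and> w21 \<in> \<int> \<and> w22 \<in> \<int>
      \<and> 2 * e1 \<in> \<int> \<and> 2 * e2 \<in> \<int> \<and> 2 * e3 \<in> \<int>"
    using assms by (simp add: order_coords_def w11_def w12_def w21_def w22_def e1_def e2_def e3_def)
  have "mk x0 x1 y1 y2 y3 \<in> End_X zz \<longleftrightarrow> w11 \<in> \<int> \<and> w12 \<in> \<int> \<and> w21 \<in> \<int> \<and> w22 \<in> \<int>
    \<and> 2 * ra1 * e1 \<in> \<int> \<and> 2 * ra1 * e2 \<in> \<int> \<and> 2 * ra1 * e3 \<in> \<int>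
    \<and> 2 * rc1 * e1 \<in> \<int> \<and> 2 * rc1 * e2 \<in> \<int> \<and> 2 * rc1 * e3 \<in> \<int>"
    unfolding mk_def End_X_zz c1 c2 c3 c4 by argo
  also have "\<dots> \<longleftrightarrow> order_coords x0 x1 y1 y2 y3"
  proof
    assume *: "w11 \<in> \<int> \<and> w12 \<in> \<int> \<and> w21 \<in> \<int> \<and> w22 \<in> \<int>
    \<and> 2 * ra1 * e1 \<in> \<int> \<and> 2 * ra1 * e2 \<in> \<int> \<and> 2 * ra1 * e3 \<in> \<int>
    \<and> 2 * rc1 * e1 \<in> \<int> \<and> 2 * rc1 * e2 \<in> \<int> \<and> 2 * rc1 * e3 \<in> \<int>"
    hence w: "w11 \<in> \<int>" "w12 \<in> \<int>" "w21 \<in> \<int>" "w22 \<in> \<int>" by auto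
    have red: "2 * e \<in> \<int>" if h: "2 * ra1 * e \<in> \<int>" "2 * rc1 * e \<in> \<int>" "rb1 * (2 * e) \<in> \<int>" for e
    proof (rule Ints_of_coprime_multiples[OF coprime_a1_c1_b1 _ h(3)])
      obtain u v where "u * a1 + v * c1 = gcd a1 c1" by (metis bezout_int)
      from arg_cong[OF this, of real_of_int]
      have "real_of_int (gcd a1 c1) = of_int u * ra1 + of_int v * rc1" by simp
      hence "real_of_int (gcd a1 c1) * (2 * e) = of_int u * (2 * ra1 * e) + of_int v * (2 * rc1 * e)"
        by (simp add: algebra_simps)
      thus "real_of_int (gcd a1 c1) * (2 * e) \<in> \<int>" by (rule Ints_eqI) (intro h Ints_intros)
    qed
    \<comment> \<open>The three identities are entries of the commutator of X + b1 Y with A, which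
      equals 2 b1 Y A.\<close>
    have "rb1 * (2 * e1) = 2 * (ra * w21 + rc * w12)"
      unfolding w21_def w12_def e1_def using y by Groebner_Basis.algebra
    hence b1: "rb1 * (2 * e1) \<in> \<int>" by (rule Ints_eqI) (intro w Ints_intros)
    have "rb1 * (2 * e2) = 2 * ra * (w11 - w22) + 2 * rb * w12"
      unfolding w11_def w22_def w12_def e2_def by Groebner_Basis.algebra
    hence b2: "rb1 * (2 * e2) \<in> \<int>" by (rule Ints_eqI) (intro w Ints_intros)
    have "rb1 * (2 * e3) = 2 * rc * (w11 - w22) - 2 * rb * w21"
      unfolding w11_def w22_def w21_def e3_def by Groebner_Basis.algebra
    hence b3: "rb1 * (2 * e3) \<in> \<int>" by (rule Ints_eqI) (intro w Ints_intros)
    show "order_coords x0 x1 y1 y2 y3" unfolding order_coords_iff using * red[OF _ _ b1] red[OF _ _ b2] red[OF _ _ b3] by blast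
  next
    assume "order_coords x0 x1 y1 y2 y3"
    hence l: "w11 \<in> \<int>" "w12 \<in> \<int>" "w21 \<in> \<int>" "w22 \<in> \<int>" "2 * e1 \<in> \<int>" "2 * e2 \<in> \<int>" "2 * e3 \<in> \<int>"
      unfolding order_coords_iff by auto
    have "2 * real_of_int k * e \<in> \<int>" if "2 * e \<in> \<int>" for k and e :: real
    proof -
      have "2 * real_of_int k * e = real_of_int k * (2 * e)" by simp
      thus ?thesis by (rule Ints_eqI) (intro that Ints_intros)
    qed
    thus "w11 \<in> \<int> \<and> w12 \<in> \<int> \<and> w21 \<in> \<int> \<and> w22 \<in> \<int>
    \<and> 2 * ra1 * e1 \<in> \<int> \<and> 2 * ra1 * e2 \<in> \<int> \<and> 2 * ra1 * e3 \<in> \<int>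
    \<and> 2 * rc1 * e1 \<in> \<int> \<and> 2 * rc1 * e2 \<in> \<int> \<and> 2 * rc1 * e3 \<in> \<int>" using l by blast
  qed
  finally show ?thesis .
qed

end

subsection \<open>Orders and integrality\<close>

lemma Rats_common_denominator:
  fixes X :: "real set"
  assumes "finite X" "X \<subseteq> \<rat>"
  shows "\<exists>d::nat. d > 0 \<and> (\<forall>x\<in>X. real d * x \<in> \<int>)"
  using assms
proof (induction X rule: finite_induct)
  case empty
  show ?case by (intro exI[of _ 1]) simp
next
  case (insert x X)
  then obtain d :: nat where d: "d > 0" "\<forall>x\<in>X. real d * x \<in> \<int>" by auto
  from insert have "x \<in> \<rat>" by simp
  then obtain p q where pq: "q > 0" "x = of_int p / of_int q" by (elim Rats_cases')
  have "real (nat q * d) * y \<in> \<int>" if "y \<in> insert x X" for y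
  proof (cases "y = x")
    case True
    hence "real (nat q * d) * y = of_int (int d * p)" using pq by simp
    thus ?thesis by (metis Ints_of_int)
  next
    case False
    hence "real d * y \<in> \<int>" using d that by auto
    moreover have "real (nat q * d) * y = of_int q * (real d * y)" using pq(1) by simp
    ultimately show ?thesis by (simp only: Ints_mult Ints_of_int)
  qed
  thus ?case using d(1) pq(1) by (intro exI[of _ "nat q * d"]) auto
qed

text \<open>For r = p / q in lowest terms every power of q divides e. The exponent e already gives a
  contradiction when q is at least 2, because 2^e exceeds e.\<close>

lemma Ints_of_bounded_denominator_powers:
  fixes r :: "'a::field_char_0"
  assumes "r \<in> \<rat>" "e > (0::nat)" "\<And>k. of_nat e * r ^ k \<in> \<int>"
  shows "r \<in> \<int>"
proof -
  from assms(1) obtain p q where pq: "q > 0" "coprime p q" "r = of_int p / of_int q" by (elim Rats_cases')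
  have dv: "q ^ k dvd int e" for k
  proof -
    obtain m where "of_nat e * r ^ k = of_int m" using assms(3) by (metis Ints_cases)
    hence "(of_int (int e * p ^ k) :: 'a) = of_int (m * q ^ k)"
      using pq by (simp add: power_divide field_simps)
    hence "int e * p ^ k = m * q ^ k" by (simp only: of_int_eq_iff)
    hence "q ^ k dvd int e * p ^ k" by simp
    moreover have "coprime (q ^ k) (p ^ k)" using pq(2) by (simp add: coprime_commute)
    ultimately show ?thesis by (simp add: coprime_dvd_mult_left_iff)
  qed
  have "q = 1"
  proof (rule ccontr)
    assume "q \<noteq> 1"
    hence "q \<ge> 2" using pq(1) by simp
    have "int e < 2 ^ e" by (metis of_nat_less_two_power)
    also have "(2::int) ^ e \<le> q ^ e" using \<open>q \<ge> 2\<close> by (intro power_mono) auto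
    also have "q ^ e \<le> int e" using dv assms(2) by (intro zdvd_imp_le) auto
    finally show False by simp
  qed
  thus ?thesis using pq by simp
qed

definition zspan :: "(complex^2^2) set \<Rightarrow> (complex^2^2) set" where
  "zspan G = {sum (\<lambda>g. cscale (c g) g) G | c. \<forall>g\<in>G. c g \<in> \<int>}"

lemma zspanI:
  assumes "x = (\<Sum>g\<in>G. cscale (c g) g)" "\<And>g. g \<in> G \<Longrightarrow> c g \<in> \<int>"
  shows "x \<in> zspan G"
  unfolding zspan_def using assms by (intro CollectI exI[of _ c]) auto

lemma cscale_add_left: "cscale (k + l) M = cscale k M + cscale l M"
  and cscale_add_right: "cscale k (M + M') = cscale k M + cscale k M'"
  and cscale_cscale: "cscale k (cscale l M) = cscale (k * l) M"
  and cscale_one: "cscale 1 M = M" and cscale_zero: "cscale 0 M = 0"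
  and cscale_zero_right: "cscale k 0 = 0"
  by (simp_all add: mat2_eq_iff algebra_simps)

lemma cscale_sum: "cscale k (sum f G) = (\<Sum>g\<in>G. cscale k (f g))"
  by (induction G rule: infinite_finite_induct) (simp_all add: cscale_zero_right cscale_add_right)

lemma zspan_base:
  assumes "finite G" "g \<in> G" shows "g \<in> zspan G"
proof -
  have "g = (\<Sum>h\<in>G. if h = g then h else 0)" using assms by simp
  also have "\<dots> = (\<Sum>h\<in>G. cscale (if h = g then 1 else 0) h)"
    by (intro sum.cong) (auto simp: cscale_one cscale_zero)
  finally show ?thesis by (rule zspanI) simp
qed

lemma zspan_add:
  assumes "x \<in> zspan G" "y \<in> zspan G" shows "x + y \<in> zspan G"
proof -
  obtain c d where "x = (\<Sum>g\<in>G. cscale (c g) g)" "\<forall>g\<in>G. c g \<in> \<int>"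
    "y = (\<Sum>g\<in>G. cscale (d g) g)" "\<forall>g\<in>G. d g \<in> \<int>" using assms by (auto simp: zspan_def)
  thus ?thesis by (intro zspanI[of _ "\<lambda>g. c g + d g"]) (simp_all add: cscale_add_left sum.distrib)
qed

lemma zspan_scale:
  assumes "x \<in> zspan G" shows "cscale (of_int k) x \<in> zspan G"
proof -
  obtain c where "x = (\<Sum>g\<in>G. cscale (c g) g)" "\<forall>g\<in>G. c g \<in> \<int>" using assms by (auto simp: zspan_def)
  thus ?thesis by (intro zspanI[of _ "\<lambda>g. of_int k * c g"]) (simp_all add: cscale_sum cscale_cscale)
qed

lemma zspan_subset:
  assumes "G \<subseteq> S" "0 \<in> S" "\<And>x y. x \<in> S \<Longrightarrow> y \<in> S \<Longrightarrow> x + y \<in> S"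
    and "\<And>k x. x \<in> S \<Longrightarrow> cscale (of_int k) x \<in> S"
  shows "zspan G \<subseteq> S"
proof
  fix x assume "x \<in> zspan G"
  then obtain c where x: "x = (\<Sum>g\<in>G. cscale (c g) g)" and c: "\<forall>g\<in>G. c g \<in> \<int>" by (auto simp: zspan_def)
  have "(\<Sum>g\<in>F. cscale (c g) g) \<in> S" if "F \<subseteq> G" for F
    using that
  proof (induction F rule: infinite_finite_induct)
    case (insert g F)
    have "cscale (c g) g \<in> S" using insert.prems assms(1,4) c by (metis Ints_cases insert_subset subsetD)
    thus ?case using insert assms(3) by simp
  qed (use assms(2) in auto)
  thus "x \<in> S" using x by blast
qed

text \<open>As \<open>Ord\<close> is finitely generated, a single d carries it into R. Hence d^2
  det(M)^k = det (d M^k) is integral for every k, so the powers of det M have bounded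
  denominators.\<close>

lemma is_order_det_Ints:
  assumes O: "is_order S Ord" and R: "is_order S R" and Rdet: "\<forall>x\<in>R. det x \<in> \<int>"
    and M: "M \<in> Ord"
  shows "det M \<in> \<int>"
proof -
  have Ro: "Ord \<subseteq> S" "mat 1 \<in> Ord" "\<And>x y. x \<in> Ord \<Longrightarrow> y \<in> Ord \<Longrightarrow> x ** y \<in> Ord"
    using O by (auto simp: is_order_def)
  obtain G where G: "finite G" "G \<subseteq> Ord" "Ord = zspan G" using O unfolding is_order_def zspan_def by blast
  have Radd: "\<And>x y. x \<in> R \<Longrightarrow> y \<in> R \<Longrightarrow> x + y \<in> R" "\<And>x y. x \<in> R \<Longrightarrow> y \<in> R \<Longrightarrow> x - y \<in> R"
    using R by (auto simp: is_order_def)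
  obtain G' where G': "finite G'" "R = zspan G'" using R unfolding is_order_def zspan_def by blast
  have Rsc: "cscale (of_int k) x \<in> R" if "x \<in> R" for k x using that zspan_scale G' by blast
  have R0: "0 \<in> R" using R Radd(2) unfolding is_order_def by (metis diff_self)
  have "\<forall>g\<in>G. \<exists>n::nat. n > 0 \<and> cscale (of_nat n) g \<in> R"
    using R G(2) Ro(1) unfolding is_order_def by blast
  then obtain n :: "complex^2^2 \<Rightarrow> nat" where n: "\<And>g. g \<in> G \<Longrightarrow> n g > 0 \<and> cscale (of_nat (n g)) g \<in> R" by metis
  define d where "d = (\<Prod>g\<in>G. n g)"
  have d0: "d > 0" unfolding d_def using n by (intro prod_pos) auto
  have "zspan G \<subseteq> {x. cscale (of_nat d) x \<in> R}"
  proof (rule zspan_subset)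
    show "G \<subseteq> {x. cscale (of_nat d) x \<in> R}"
    proof safe
      fix g assume g: "g \<in> G"
      hence "n g dvd d" unfolding d_def using G(1) by auto
      then obtain m where "d = m * n g" by (metis dvdE mult.commute)
      hence "cscale (of_nat d) g = cscale (of_int (int m)) (cscale (of_nat (n g)) g)"
        by (simp add: cscale_cscale)
      thus "cscale (of_nat d) g \<in> R" using Rsc n g by metis
    qed
    show "0 \<in> {x. cscale (of_nat d) x \<in> R}" using R0 by (simp add: cscale_zero_right)
    show "x + y \<in> {x. cscale (of_nat d) x \<in> R}" if "x \<in> {x. cscale (of_nat d) x \<in> R}" "y \<in> {x. cscale (of_nat d) x \<in> R}" for x y
      using that Radd(1) by (simp add: cscale_add_right)
    show "cscale (of_int k) x \<in> {x. cscale (of_nat d) x \<in> R}" if "x \<in> {x. cscale (of_nat d) x \<in> R}" for k x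
    proof -
      have "cscale (of_nat d) (cscale (of_int k) x) = cscale (of_int k) (cscale (of_nat d) x)"
        by (simp add: cscale_cscale mult.commute)
      thus ?thesis using that Rsc by simp
    qed
  qed
  hence dO: "cscale (of_nat d) x \<in> R" if "x \<in> Ord" for x using that G(3) by blast
  have det_sc: "det (cscale k x) = k\<^sup>2 * det x" for k x
    by (simp add: det_2 power2_eq_square algebra_simps)
  have pow: "of_nat (d\<^sup>2) * det M ^ k \<in> \<int>" for k
  proof -
    have "\<exists>P\<in>Ord. det P = det M ^ k"
    proof (induction k)
      case 0
      show ?case using Ro(2) by (intro bexI[of _ "mat 1"]) auto
    next
      case (Suc k)
      then obtain P where "P \<in> Ord" "det P = det M ^ k" by blast
      thus ?case using Ro(3)[OF M] by (intro bexI[of _ "M ** P"]) (auto simp: det_mul)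
    qed
    then obtain P where "P \<in> Ord" "det P = det M ^ k" by blast
    thus ?thesis using bspec[OF Rdet dO, of P] by (simp add: det_sc)
  qed
  show ?thesis
  proof (rule Ints_of_bounded_denominator_powers[OF _ _ pow])
    show "d\<^sup>2 > 0" using d0 by simp
    have "of_nat (d\<^sup>2) * det M \<in> \<rat>" using pow[of 1] Ints_subset_Rats by auto
    hence "(of_nat (d\<^sup>2) * det M) / of_nat (d\<^sup>2) \<in> \<rat>" by (intro Rats_divide) auto
    thus "det M \<in> \<rat>" using d0 by simp
  qed
qed

lemma trace_2: "trace M = M $ 1 $ 1 + M $ 2 $ 2" for M :: "'a::semiring_1^2^2"
  by (simp add: trace_def sum_2)

text \<open>Polarisation: det (1 + M) = 1 + tr M + det M.\<close>

lemma is_order_trace_Ints: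
  assumes "is_order S Ord" "is_order S R" "\<forall>x\<in>R. det x \<in> \<int>" "M \<in> Ord"
  shows "trace M \<in> \<int>"
proof -
  have "mat 1 + M \<in> Ord" using assms(1,4) by (auto simp: is_order_def)
  hence "det (mat 1 + M) \<in> \<int>" "det M \<in> \<int>" using is_order_det_Ints[OF assms(1-3)] assms(4) by auto
  moreover have "trace M = det (mat 1 + M) - det M - 1"
    by (simp add: trace_2 det_2 mat_def algebra_simps)
  ultimately show ?thesis by (simp only: Ints_diff Ints_1)
qed

lemma of_rat_complex_of_real:
  obtains \<rho> where "(of_rat r :: complex) = of_real \<rho>" "\<rho> \<in> \<rat>"
proof -
  have "(of_rat r :: complex) \<in> \<rat>" by simp
  then obtain p q where "(of_rat r :: complex) = of_int p / of_int q" by (elim Rats_cases')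
  hence "(of_rat r :: complex) = of_real (of_int p / of_int q)" by simp
  thus ?thesis using that by (metis Rats_divide Rats_of_int)
qed

section \<open>The order and the algebra in coordinates\<close>

context form_pair
begin

lemma mk_add: "mk x0 x1 y1 y2 y3 + mk x0' x1' y1' y2' y3' = mk (x0 + x0') (x1 + x1') (y1 + y1') (y2 + y2') (y3 + y3')"
  by (simp add: mk_def mat2_eq_iff complex_eq_iff algebra_simps)

lemma mk_scale: "cscale (of_real k) (mk x0 x1 y1 y2 y3) = mk (k * x0) (k * x1) (k * y1) (k * y2) (k * y3)"
  by (simp add: mk_def mat2_eq_iff complex_eq_iff algebra_simps)

lemma mk_one: "mk 1 0 0 0 0 = mat 1" and mk_zero: "mk 0 0 0 0 0 = 0"
  by (simp_all add: mk_def mat2_eq_iff complex_eq_iff mat_def)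

lemma order_coordsD:
  assumes "order_coords x0 x1 y1 y2 y3"
  shows "anticomm y1 y2 y3"
    "x0 - rb * x1 + rb1 * y1 \<in> \<int>" "2 * ra * x1 + rb1 * y2 \<in> \<int>" "- 2 * rc * x1 + rb1 * y3 \<in> \<int>"
    "x0 + rb * x1 - rb1 * y1 \<in> \<int>" "2 * (rb * y1 + 2 * rc * y2) \<in> \<int>" "2 * (2 * ra * y1 + rb * y2) \<in> \<int>"
    "2 * (2 * rc * y1 - rb * y3) \<in> \<int>"
  using assms by (auto simp: order_coords_def)

lemmas order_coords_anticomm = order_coordsD(1)

lemma Rz_zz: "M \<in> Rz zz \<longleftrightarrow> (\<exists>x0 x1 y1 y2 y3. order_coords x0 x1 y1 y2 y3 \<and> M = mk x0 x1 y1 y2 y3)"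
proof
  assume "M \<in> Rz zz"
  hence M: "M \<in> End_X zz" "ctrans M ** Hz zz = Hz zz ** iota M" by (auto simp: Rz_def)
  obtain x0 x1 y1 y2 y3 where "anticomm y1 y2 y3" "M = mk x0 x1 y1 y2 y3" by (rule hermitian_imp_mk[OF M(2)])
  thus "\<exists>x0 x1 y1 y2 y3. order_coords x0 x1 y1 y2 y3 \<and> M = mk x0 x1 y1 y2 y3" using M(1) mk_in_End_X by blast
next
  assume "\<exists>x0 x1 y1 y2 y3. order_coords x0 x1 y1 y2 y3 \<and> M = mk x0 x1 y1 y2 y3"
  thus "M \<in> Rz zz" unfolding Rz_def using mk_in_End_X hermitian_mk order_coords_anticomm by blast
qed

text \<open>The combination for x1 is minus the trace of (X + b1 Y) A, from which Y drops out
  because Y A has trace zero. Those for y1 and y2 come from multiplying 2 Y A by -A.\<close>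

lemma order_coords_integral_coords:
  assumes "order_coords x0 x1 y1 y2 y3"
  shows "2 * rN * x0 \<in> \<int>" "2 * rN * x1 \<in> \<int>" "2 * rN * y1 \<in> \<int>" "2 * rN * y2 \<in> \<int>"
proof -
  have y: "ra * y3 = rb * y1 + rc * y2" using order_coords_anticomm[OF assms] by (simp add: anticomm_def)
  note l = order_coordsD(2-)[OF assms]
  have "2 * rN * x0 = rN * ((x0 - rb * x1 + rb1 * y1) + (x0 + rb * x1 - rb1 * y1))" by simp
  thus "2 * rN * x0 \<in> \<int>" by (rule Ints_eqI) (intro l Ints_intros)
  have "2 * rN * x1 = rb * ((x0 - rb * x1 + rb1 * y1) - (x0 + rb * x1 - rb1 * y1))
      + 2 * rc * (2 * ra * x1 + rb1 * y2) - 2 * ra * (- 2 * rc * x1 + rb1 * y3)"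
    unfolding real_form_disc using y by Groebner_Basis.algebra
  thus "2 * rN * x1 \<in> \<int>" by (rule Ints_eqI) (intro l Ints_intros)
  have "2 * rN * y1 = 2 * rc * (2 * (2 * ra * y1 + rb * y2)) - rb * (2 * (rb * y1 + 2 * rc * y2))"
    unfolding real_form_disc by Groebner_Basis.algebra
  thus "2 * rN * y1 \<in> \<int>" by (rule Ints_eqI) (intro l Ints_intros)
  have "2 * rN * y2 = 2 * ra * (2 * (rb * y1 + 2 * rc * y2)) - rb * (2 * (2 * ra * y1 + rb * y2))"
    unfolding real_form_disc by Groebner_Basis.algebra
  thus "2 * rN * y2 \<in> \<int>" by (rule Ints_eqI) (intro l Ints_intros)
qed

lemma anticomm_iff: "anticomm y1 y2 y3 \<longleftrightarrow> y3 = (rb * y1 + rc * y2) / ra"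
  using pos_facts(1) by (auto simp: anticomm_def field_simps)

lemma order_coords_Rats:
  assumes "order_coords x0 x1 y1 y2 y3"
  shows "x0 \<in> \<rat>" "x1 \<in> \<rat>" "y1 \<in> \<rat>" "y2 \<in> \<rat>" "y3 \<in> \<rat>"
proof -
  have "x \<in> \<rat>" if "2 * rN * x \<in> \<int>" for x
  proof -
    have "2 * rN * x \<in> \<rat>" using that Ints_subset_Rats by blast
    hence "(2 * rN * x) / (2 * rN) \<in> \<rat>" by (intro Rats_divide) auto
    thus ?thesis using pos_facts by simp
  qed
  thus *: "x0 \<in> \<rat>" "x1 \<in> \<rat>" "y1 \<in> \<rat>" "y2 \<in> \<rat>" using order_coords_integral_coords[OF assms] by auto
  show "y3 \<in> \<rat>" using order_coords_anticomm[OF assms] * unfolding anticomm_iff by simp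
qed

lemma order_coords_of_Ints:
  assumes "anticomm y1 y2 y3" and "x0 \<in> \<int>" "x1 \<in> \<int>" "y1 \<in> \<int>" "y2 \<in> \<int>" "y3 \<in> \<int>"
  shows "order_coords x0 x1 y1 y2 y3"
  unfolding order_coords_def using assms(1) by (intro conjI) (simp_all add: assms(2-))

lemma anticomm_scale: "anticomm y1 y2 y3 \<Longrightarrow> anticomm (k * y1) (k * y2) (k * y3)"
  unfolding anticomm_def by Groebner_Basis.algebra

lemma rational_mk_multiple:
  assumes "anticomm y1 y2 y3" "x0 \<in> \<rat>" "x1 \<in> \<rat>" "y1 \<in> \<rat>" "y2 \<in> \<rat>" "y3 \<in> \<rat>"
  obtains d :: nat where "d > 0" "order_coords (real d * x0) (real d * x1) (real d * y1) (real d * y2) (real d * y3)"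
proof -
  obtain d :: nat where "d > 0" "\<forall>x\<in>{x0, x1, y1, y2, y3}. real d * x \<in> \<int>"
    using Rats_common_denominator[of "{x0, x1, y1, y2, y3}"] assms by auto
  thus ?thesis using that[of d] order_coords_of_Ints[OF anticomm_scale[OF assms(1)]] by auto
qed

text \<open>Removing a nonzero rational factor leaves a Hermitian endomorphism, whose coordinates
  are rational. Conversely a common denominator moves rational coordinates into the order.\<close>

lemma Bz_zz: "M \<in> Bz zz \<longleftrightarrow> (\<exists>x0 x1 y1 y2 y3. anticomm y1 y2 y3 \<and> x0 \<in> \<rat> \<and> x1 \<in> \<rat> \<and> y1 \<in> \<rat> \<and> y2 \<in> \<rat> \<and> y3 \<in> \<rat>
    \<and> M = mk x0 x1 y1 y2 y3)"
proof
  assume M: "M \<in> Bz zz"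
  then obtain r M' where M': "M = cscale (of_rat r) M'" "M' \<in> End_X zz" by (auto simp: Bz_def EndQ_X_def)
  obtain \<rho> where \<rho>: "(of_rat r :: complex) = of_real \<rho>" "\<rho> \<in> \<rat>" by (rule of_rat_complex_of_real)
  have h: "ctrans M ** Hz zz = Hz zz ** iota M" using M by (auto simp: Bz_def)
  obtain x0 x1 y1 y2 y3 where x: "anticomm y1 y2 y3" "M = mk x0 x1 y1 y2 y3" by (rule hermitian_imp_mk[OF h])
  show "\<exists>x0 x1 y1 y2 y3. anticomm y1 y2 y3 \<and> x0 \<in> \<rat> \<and> x1 \<in> \<rat> \<and> y1 \<in> \<rat> \<and> y2 \<in> \<rat> \<and> y3 \<in> \<rat>
    \<and> M = mk x0 x1 y1 y2 y3"
  \<comment> \<open>A zero factor says nothing about \<open>M'\<close>, which need not satisfy the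
    Hermitian condition; then M is zero.\<close>
  proof (cases "\<rho> = 0")
    case True
    hence "M = mk 0 0 0 0 0" using M' \<rho> by (simp add: mk_zero cscale_zero)
    moreover have "anticomm 0 0 0" by (simp add: anticomm_def)
    ultimately show ?thesis by (metis Rats_0)
  next
    case False
    hence "M' = cscale (of_real (1 / \<rho>)) M" using M' \<rho> by (simp add: cscale_cscale cscale_one)
    hence M'': "M' = mk (1 / \<rho> * x0) (1 / \<rho> * x1) (1 / \<rho> * y1) (1 / \<rho> * y2) (1 / \<rho> * y3)" by (simp only: x(2) mk_scale)
    have "order_coords (1 / \<rho> * x0) (1 / \<rho> * x1) (1 / \<rho> * y1) (1 / \<rho> * y2) (1 / \<rho> * y3)"
      using M'(2) unfolding M'' by (subst (asm) mk_in_End_X[OF anticomm_scale[OF x(1)]])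
    note q = order_coords_Rats[OF this]
    have "x \<in> \<rat>" if "1 / \<rho> * x \<in> \<rat>" for x
    proof -
      have "\<rho> * (1 / \<rho> * x) \<in> \<rat>" using that \<rho>(2) by (rule Rats_mult[rotated])
      thus ?thesis using False by simp
    qed
    thus ?thesis using q x by blast
  qed
next
  assume "\<exists>x0 x1 y1 y2 y3. anticomm y1 y2 y3 \<and> x0 \<in> \<rat> \<and> x1 \<in> \<rat> \<and> y1 \<in> \<rat> \<and> y2 \<in> \<rat> \<and> y3 \<in> \<rat>
    \<and> M = mk x0 x1 y1 y2 y3"
  then obtain x0 x1 y1 y2 y3 where x: "anticomm y1 y2 y3" "x0 \<in> \<rat>" "x1 \<in> \<rat>" "y1 \<in> \<rat>" "y2 \<in> \<rat>" "y3 \<in> \<rat>"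
    and M: "M = mk x0 x1 y1 y2 y3" by blast
  obtain d :: nat where d: "d > 0" "order_coords (real d * x0) (real d * x1) (real d * y1) (real d * y2) (real d * y3)"
    by (rule rational_mk_multiple[OF x])
  define M' where "M' = mk (real d * x0) (real d * x1) (real d * y1) (real d * y2) (real d * y3)"
  have "M' \<in> End_X zz" unfolding M'_def using mk_in_End_X[OF order_coords_anticomm[OF d(2)]] d(2) by blast
  moreover have "M = cscale (of_rat (1 / of_nat d)) M'"
  proof -
    have "M' = cscale (of_real (real d)) M" unfolding M M'_def mk_scale ..
    thus ?thesis using d(1) by (simp add: cscale_cscale cscale_one of_rat_divide)
  qed
  ultimately have "M \<in> EndQ_X zz" unfolding EndQ_X_def by blast
  thus "M \<in> Bz zz" unfolding Bz_def using hermitian_mk[OF x(1)] M by blast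
qed

lemma order_coords_lincomb:
  assumes "order_coords x0 x1 y1 y2 y3" "order_coords x0' x1' y1' y2' y3'"
  shows "order_coords (x0 + of_int k * x0') (x1 + of_int k * x1') (y1 + of_int k * y1') (y2 + of_int k * y2') (y3 + of_int k * y3')"
proof -
  note l = order_coordsD[OF assms(1)] and l' = order_coordsD[OF assms(2)]
  have lin: "r \<in> \<int>" if "r = p + of_int k * q" "p \<in> \<int>" "q \<in> \<int>" for p q r :: real using that by simp
  show ?thesis
    unfolding order_coords_def
  proof (intro conjI)
    show "anticomm (y1 + of_int k * y1') (y2 + of_int k * y2') (y3 + of_int k * y3')"
      using l(1) l'(1) unfolding anticomm_def by Groebner_Basis.algebra
  qed (rule lin[OF _ l(2) l'(2)] lin[OF _ l(3) l'(3)] lin[OF _ l(4) l'(4)] lin[OF _ l(5) l'(5)]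
      lin[OF _ l(6) l'(6)] lin[OF _ l(7) l'(7)] lin[OF _ l(8) l'(8)], simp add: algebra_simps)+
qed

lemma Rz_lincomb:
  assumes "M \<in> Rz zz" "M' \<in> Rz zz" shows "M + cscale (of_int k) M' \<in> Rz zz"
proof -
  obtain x0 x1 y1 y2 y3 where x: "order_coords x0 x1 y1 y2 y3" "M = mk x0 x1 y1 y2 y3" using assms(1) Rz_zz by blast
  obtain x0' x1' y1' y2' y3' where x': "order_coords x0' x1' y1' y2' y3'" "M' = mk x0' x1' y1' y2' y3'"
    using assms(2) Rz_zz by blast
  have "M + cscale (of_int k) M' = M + cscale (of_real (of_int k)) M'" by simp
  also have "\<dots> = mk (x0 + of_int k * x0') (x1 + of_int k * x1') (y1 + of_int k * y1') (y2 + of_int k * y2') (y3 + of_int k * y3')"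
    unfolding x x' mk_scale mk_add ..
  finally show ?thesis using order_coords_lincomb[OF x(1) x'(1)] Rz_zz by blast
qed

lemma mat_1_in_Rz: "mat 1 \<in> Rz zz"
  unfolding Rz_zz mk_one[symmetric] by (metis order_coords_of_Ints anticomm_def Ints_0 Ints_1 add.right_neutral mult_zero_right)

lemma Rz_add: "M \<in> Rz zz \<Longrightarrow> M' \<in> Rz zz \<Longrightarrow> M + M' \<in> Rz zz"
  using Rz_lincomb[of M M' 1] by (simp add: cscale_one)

lemma Rz_diff: "M \<in> Rz zz \<Longrightarrow> M' \<in> Rz zz \<Longrightarrow> M - M' \<in> Rz zz"
proof -
  assume "M \<in> Rz zz" "M' \<in> Rz zz"
  hence "M + cscale (of_int (-1)) M' \<in> Rz zz" by (rule Rz_lincomb)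
  moreover have "M + cscale (of_int (-1)) M' = M - M'" by (simp add: mat2_eq_iff)
  ultimately show ?thesis by simp
qed

lemma Rz_0: "0 \<in> Rz zz"
  using Rz_diff[OF mat_1_in_Rz mat_1_in_Rz] by simp

lemma Rz_scale: "M \<in> Rz zz \<Longrightarrow> cscale (of_int k) M \<in> Rz zz"
  using Rz_lincomb[OF Rz_0, of M k] by simp

text \<open>Both \<open>ctrans\<close> and \<open>iota\<close> reverse products, so the Hermitian
  condition passes to products without a computation in coordinates.\<close>

lemma Rz_mult:
  assumes "M \<in> Rz zz" "M' \<in> Rz zz" shows "M ** M' \<in> Rz zz"
proof -
  have "M ** M' \<in> End_X zz"
    using assms by (auto simp: Rz_def End_X_def matrix_vector_mul_assoc[symmetric])
  moreover have "ctrans (M ** M') ** Hz zz = Hz zz ** iota (M ** M')"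
  proof -
    have "ctrans (M ** M') ** Hz zz = ctrans M' ** (ctrans M ** Hz zz)" by (simp add: ctrans_mult matrix_mul_assoc)
    also have "\<dots> = (ctrans M' ** Hz zz) ** iota M" using assms(1) by (simp add: Rz_def matrix_mul_assoc)
    also have "\<dots> = Hz zz ** iota (M ** M')" using assms(2) by (simp add: Rz_def iota_mult matrix_mul_assoc)
    finally show ?thesis .
  qed
  ultimately show ?thesis by (simp add: Rz_def)
qed

text \<open>In the coordinates \<open>(x0, x1, y1, y2)\<close> the order lies between \<open>a\<int>\<^sup>4\<close> and \<open>(1 / 2N)\<int>\<^sup>4\<close>, so it
  is generated by the former together with the finitely many residues modulo it.\<close>
lemma Rz_finitely_generated: "\<exists>G. finite G \<and> G \<subseteq> Rz zz \<and> Rz zz = zspan G"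
proof -
  define mkc where "mkc v = (case v of (i, j, k, l) \<Rightarrow>
     mk (real_of_int i / (2 * rN)) (real_of_int j / (2 * rN)) (real_of_int k / (2 * rN)) (real_of_int l / (2 * rN))
       ((rb * (real_of_int k / (2 * rN)) + rc * (real_of_int l / (2 * rN))) / ra))"
    for v :: "int \<times> int \<times> int \<times> int"
  \<comment> \<open>In units of 1 / (2 N) this is the integer a. A multiple of a is taken so that y3
    = (b y1 + c y2) / a is integral on the generators in \<open>B\<close>.\<close>
  define K where "K = 2 * N * a"
  have K: "K > 0" using N_pos a_pos by (simp add: K_def)
  define I where "I = {0..<K}"
  define F where "F = mkc ` (I \<times> I \<times> I \<times> I)"
  define B where "B = {mkc (K, 0, 0, 0), mkc (0, K, 0, 0), mkc (0, 0, K, 0), mkc (0, 0, 0, K)}"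
  define G where "G = (F \<inter> Rz zz) \<union> B"
  have N0: "rN \<noteq> 0" "ra \<noteq> 0" using pos_facts by auto
  have lin: "mkc (i, j, k, l) + cscale (of_int t) (mkc (i', j', k', l')) = mkc (i + t * i', j + t * j', k + t * k', l + t * l')"
    for i j k l i' j' k' l' t
  proof -
    have "mkc (i, j, k, l) + cscale (of_real (of_int t)) (mkc (i', j', k', l')) = mkc (i + t * i', j + t * j', k + t * k', l + t * l')"
      unfolding mkc_def prod.case mk_scale mk_add by (simp add: add_divide_distrib algebra_simps)
    thus ?thesis by simp
  qed
  have B: "B \<subseteq> Rz zz"
  proof -
    have "mkc (K, 0, 0, 0) = mk ra 0 0 0 0" "mkc (0, K, 0, 0) = mk 0 ra 0 0 0"
      "mkc (0, 0, K, 0) = mk 0 0 ra 0 rb" "mkc (0, 0, 0, K) = mk 0 0 0 ra rc"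
      using N0 by (simp_all add: mkc_def K_def)
    moreover have "order_coords ra 0 0 0 0" "order_coords 0 ra 0 0 0" "order_coords 0 0 ra 0 rb" "order_coords 0 0 0 ra rc"
      by (rule order_coords_of_Ints; simp add: anticomm_def)+
    ultimately show ?thesis unfolding B_def using Rz_zz by blast
  qed
  have fin: "finite G" unfolding G_def F_def I_def B_def by auto
  have GR: "G \<subseteq> Rz zz" using B by (auto simp: G_def)
  have "Rz zz \<subseteq> zspan G"
  proof
    fix M assume M: "M \<in> Rz zz"
    then obtain x0 x1 y1 y2 y3 where x: "order_coords x0 x1 y1 y2 y3" "M = mk x0 x1 y1 y2 y3" using Rz_zz by blast
    obtain i j k l where c: "2 * rN * x0 = of_int i" "2 * rN * x1 = of_int j" "2 * rN * y1 = of_int k" "2 * rN * y2 = of_int l"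
      using order_coords_integral_coords[OF x(1)] by (metis Ints_cases)
    have "x0 = of_int i / (2 * rN)" "x1 = of_int j / (2 * rN)" "y1 = of_int k / (2 * rN)" "y2 = of_int l / (2 * rN)"
      using N0 by (simp_all flip: c)
    hence Mc: "M = mkc (i, j, k, l)"
      using order_coords_anticomm[OF x(1)] unfolding x(2) mkc_def prod.case anticomm_iff by simp
    define P where "P = mkc (i mod K, j mod K, k mod K, l mod K)"
    have dec: "M = P + cscale (of_int (i div K)) (mkc (K, 0, 0, 0)) + cscale (of_int (j div K)) (mkc (0, K, 0, 0))
       + cscale (of_int (k div K)) (mkc (0, 0, K, 0)) + cscale (of_int (l div K)) (mkc (0, 0, 0, K))"
      unfolding P_def lin Mc by simp
    hence "P = M - (cscale (of_int (i div K)) (mkc (K, 0, 0, 0)) + cscale (of_int (j div K)) (mkc (0, K, 0, 0))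
       + cscale (of_int (k div K)) (mkc (0, 0, K, 0)) + cscale (of_int (l div K)) (mkc (0, 0, 0, K)))"
      by (simp add: algebra_simps)
    moreover have "cscale (of_int (i div K)) (mkc (K, 0, 0, 0)) + cscale (of_int (j div K)) (mkc (0, K, 0, 0))
       + cscale (of_int (k div K)) (mkc (0, 0, K, 0)) + cscale (of_int (l div K)) (mkc (0, 0, 0, K)) \<in> Rz zz"
      using B by (intro Rz_add Rz_scale) (auto simp: B_def)
    ultimately have "P \<in> Rz zz" using Rz_diff M by simp
    moreover have "P \<in> F" unfolding P_def F_def I_def using K by (intro imageI) auto
    ultimately have P: "P \<in> zspan G" by (intro zspan_base[OF fin]) (auto simp: G_def)
    have g: "g \<in> zspan G" if "g \<in> B" for g using that by (intro zspan_base[OF fin]) (auto simp: G_def)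
    show "M \<in> zspan G" unfolding dec
      by (intro zspan_add zspan_scale P g) (auto simp: B_def)
  qed
  moreover have "zspan G \<subseteq> Rz zz" by (rule zspan_subset[OF GR Rz_0 Rz_add Rz_scale])
  ultimately show ?thesis using fin GR by blast
qed

lemma Rz_is_order: "is_order (Bz zz) (Rz zz)"
  unfolding is_order_def
proof (intro conjI ballI)
  show "Rz zz \<subseteq> Bz zz"
  proof
    fix M assume "M \<in> Rz zz"
    then obtain x0 x1 y1 y2 y3 where x: "order_coords x0 x1 y1 y2 y3" "M = mk x0 x1 y1 y2 y3" using Rz_zz by blast
    thus "M \<in> Bz zz" unfolding Bz_zz using order_coords_Rats[OF x(1)] order_coords_anticomm[OF x(1)] by blast
  qed
  show "\<exists>G. finite G \<and> G \<subseteq> Rz zz \<and> Rz zz = {sum (\<lambda>g. cscale (c g) g) G | c. \<forall>g\<in>G. c g \<in> \<int>}"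
    using Rz_finitely_generated unfolding zspan_def .
  fix M assume "M \<in> Bz zz"
  then obtain x0 x1 y1 y2 y3 where x: "anticomm y1 y2 y3" "x0 \<in> \<rat>" "x1 \<in> \<rat>" "y1 \<in> \<rat>" "y2 \<in> \<rat>" "y3 \<in> \<rat>"
    and M: "M = mk x0 x1 y1 y2 y3" using Bz_zz by blast
  obtain d :: nat where d: "d > 0" "order_coords (real d * x0) (real d * x1) (real d * y1) (real d * y2) (real d * y3)"
    by (rule rational_mk_multiple[OF x])
  have "cscale (of_nat d) M = cscale (of_real (real d)) M" by simp
  also have "\<dots> \<in> Rz zz" unfolding M mk_scale Rz_zz using d(2) by blast
  finally show "\<exists>n::nat. n > 0 \<and> cscale (of_nat n) M \<in> Rz zz" using d(1) by blast
qed (use mat_1_in_Rz Rz_add Rz_diff Rz_mult in auto)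

section \<open>Determinant, trace pairing and maximality\<close>

lemma det_mk:
  assumes "anticomm y1 y2 y3"
  shows "det (mk x0 x1 y1 y2 y3) = of_real (x0\<^sup>2 + rN * x1\<^sup>2 - rD * (y1\<^sup>2 + y2 * y3))"
proof -
  have y: "ra * y3 = rb * y1 + rc * y2" using assms by (simp add: anticomm_def)
  have "rD = - (s * s)" using s_sq by simp
  thus ?thesis using y unfolding det_2 mk_def mat22_nth complex_eq_iff real_form_disc
    by (simp add: algebra_simps power2_eq_square) Groebner_Basis.algebra
qed

lemma trace_mk_mult:
  "Re (trace (mk x0 x1 y1 y2 y3 ** mk x0' x1' y1' y2' y3')) =
     2 * x0 * x0' - 2 * rN * x1 * x1' + rD * (2 * y1 * y1' + y2 * y3' + y3 * y2')"
proof -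
  have "rD = - (s * s)" using s_sq by simp
  thus ?thesis unfolding trace_2 matrix_mult_2_nth mk_def mat22_nth real_form_disc
    by (simp add: algebra_simps power2_eq_square)
qed

text \<open>The cross terms vanish, so det M = det (X + b1 Y) - (b1^2 - D) det Y. With b1^2 - D = 4
  a1 N c1 and N det Y = det (Y A) the last term is a1 c1 det (2 Y A).\<close>

lemma det_Rz: "\<forall>M\<in>Rz zz. det M \<in> \<int>"
proof
  fix M assume "M \<in> Rz zz"
  then obtain x0 x1 y1 y2 y3 where x: "order_coords x0 x1 y1 y2 y3" "M = mk x0 x1 y1 y2 y3" using Rz_zz by blast
  have y: "ra * y3 = rb * y1 + rc * y2" using order_coords_anticomm[OF x(1)] by (simp add: anticomm_def)
  note l = order_coordsD(2-)[OF x(1)]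
  have "x0\<^sup>2 + rN * x1\<^sup>2 - rD * (y1\<^sup>2 + y2 * y3) =
     (x0 - rb * x1 + rb1 * y1) * (x0 + rb * x1 - rb1 * y1) - (2 * ra * x1 + rb1 * y2) * (- 2 * rc * x1 + rb1 * y3)
     + ra1 * rc1 * ((2 * (rb * y1 + 2 * rc * y2))\<^sup>2 + (2 * (2 * ra * y1 + rb * y2)) * (2 * (2 * rc * y1 - rb * y3)))"
    unfolding real_b1_disc real_form_disc using y by Groebner_Basis.algebra
  hence "x0\<^sup>2 + rN * x1\<^sup>2 - rD * (y1\<^sup>2 + y2 * y3) \<in> \<int>" by (rule Ints_eqI) (intro l Ints_intros)
  thus "det M \<in> \<int>" unfolding x(2) det_mk[OF order_coords_anticomm[OF x(1)]] of_real_in_Ints_iff .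
qed

text \<open>The test elements are \<open>1\<close>, \<open>(1 + A) / 2\<close> and \<open>b1 P + \<surd>D Q\<close>, where \<open>E = P + Q\<close> splits an elementary
  matrix \<open>E\<close> into the parts commuting and anticommuting with \<open>A\<close>; pairing with the last kind reads off
  the entries of \<open>b1 X + D Y\<close>.\<close>
lemma order_coords_of_order_above:
  assumes O: "is_order (Bz zz) Ord" "Rz zz \<subseteq> Ord" and M: "mk x0 x1 y1 y2 y3 \<in> Ord" and y: "anticomm y1 y2 y3"
  shows "order_coords x0 x1 y1 y2 y3"
proof -
  have y': "ra * y3 = rb * y1 + rc * y2" using y by (simp add: anticomm_def)
  have N0: "rN \<noteq> 0" "ra \<noteq> 0" using pos_facts by auto
  have pair: "2 * x0 * x0' - 2 * rN * x1 * x1' + rD * (2 * y1 * y1' + y2 * y3' + y3 * y2') \<in> \<int>"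
    if "order_coords x0' x1' y1' y2' y3'" for x0' x1' y1' y2' y3'
  proof -
    have "mk x0' x1' y1' y2' y3' \<in> Ord" using that O(2) Rz_zz by blast
    hence "mk x0 x1 y1 y2 y3 ** mk x0' x1' y1' y2' y3' \<in> Ord" using O(1) M by (auto simp: is_order_def)
    hence "trace (mk x0 x1 y1 y2 y3 ** mk x0' x1' y1' y2' y3') \<in> \<int>"
      by (rule is_order_trace_Ints[OF O(1) Rz_is_order det_Rz])
    then obtain m :: int where "trace (mk x0 x1 y1 y2 y3 ** mk x0' x1' y1' y2' y3') = of_int m" by (elim Ints_cases)
    hence "Re (trace (mk x0 x1 y1 y2 y3 ** mk x0' x1' y1' y2' y3')) = of_int m" by simp
    thus ?thesis unfolding trace_mk_mult by simp
  qed
  have half: "(1 - rb) / 2 \<in> \<int>" "(1 + rb) / 2 \<in> \<int>"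
  proof -
    obtain k where "b = 2 * k + 1" using b_odd by (elim oddE)
    hence "(1 - rb) / 2 = of_int (- k)" "(1 + rb) / 2 = of_int (k + 1)" by simp_all
    thus "(1 - rb) / 2 \<in> \<int>" "(1 + rb) / 2 \<in> \<int>" by (metis Ints_of_int)+
  qed
  have N0i: "N \<noteq> 0" "a \<noteq> 0" using N_pos a_pos by auto
  have Nd: "rb * rb = 4 * ra * rc - rN" using real_form_disc by (simp add: power2_eq_square)
  show ?thesis
  proof (rule order_coords_of_integral[OF y])
    have "order_coords 1 0 0 0 0" by (rule order_coords_of_Ints) (simp_all add: anticomm_def)
    from pair[OF this] show "2 * x0 \<in> \<int>" by simp
    \<comment> \<open>This is (1 + A) / 2, whose entries are integers because b is odd.\<close>
    have "order_coords (1/2) (1/2) 0 0 0" using half unfolding order_coords_def anticomm_def by (simp add: diff_divide_distrib add_divide_distrib)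
    from pair[OF this] show "x0 - rN * x1 \<in> \<int>" by simp
    \<comment> \<open>Here E has its 1 at position (1, 1). The test element belongs to the order for
      every elementary E: X + b1 Y becomes b1 E, and 2 Y A becomes the commutator E A - A E.\<close>
    have "order_coords (rb1 / 2) (rb1 * rb / (2 * rN)) (1/2 + rb * rb / (2 * rN)) (- ra * rb / rN) (rc * rb / rN)"
    proof -
      have "anticomm (1/2 + rb * rb / (2 * rN)) (- ra * rb / rN) (rc * rb / rN)"
        using N0 unfolding anticomm_def Nd by (simp add: field_simps)
      moreover have
        "rb1 / 2 - rb * (rb1 * rb / (2 * rN)) + rb1 * (1/2 + rb * rb / (2 * rN)) = rb1"
        "2 * ra * (rb1 * rb / (2 * rN)) + rb1 * (- ra * rb / rN) = 0"
        "- 2 * rc * (rb1 * rb / (2 * rN)) + rb1 * (rc * rb / rN) = 0"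
        "rb1 / 2 + rb * (rb1 * rb / (2 * rN)) - rb1 * (1/2 + rb * rb / (2 * rN)) = 0"
        using N0 by (simp_all add: field_simps)
      moreover have "2 * (rb * (1/2 + rb * rb / (2 * rN)) + 2 * rc * (- ra * rb / rN)) = 0"
        using Nd by (simp add: N0i field_simps, Groebner_Basis.algebra?)
      moreover have "2 * (2 * ra * (1/2 + rb * rb / (2 * rN)) + rb * (- ra * rb / rN)) = 2 * ra"
        using Nd by (simp add: N0i field_simps, Groebner_Basis.algebra?)
      moreover have "2 * (2 * rc * (1/2 + rb * rb / (2 * rN)) - rb * (rc * rb / rN)) = 2 * rc"
        using Nd by (simp add: N0i field_simps, Groebner_Basis.algebra?)
      ultimately show ?thesis
        by (simp only: order_coords_def Ints_0 Ints_of_int Ints_mult Ints_numeral Ints_minus simp_thms)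
    qed
    from pair[OF this]
    show "rb1 * (x0 - rb * x1) + rD * y1 \<in> \<int>"
    proof (rule Ints_eqI[rotated])
      have "2 * y1 * (1/2 + rb * rb / (2 * rN)) + y2 * (rc * rb / rN) + y3 * (- ra * rb / rN)
         = y1 + rb / rN * (rb * y1 + rc * y2 - ra * y3)" using N0 by (simp add: field_simps)
      hence "2 * y1 * (1/2 + rb * rb / (2 * rN)) + y2 * (rc * rb / rN) + y3 * (- ra * rb / rN) = y1"
        using y' by simp
      thus "rb1 * (x0 - rb * x1) + rD * y1 = 2 * x0 * (rb1 / 2) - 2 * rN * x1 * (rb1 * rb / (2 * rN))
        + rD * (2 * y1 * (1/2 + rb * rb / (2 * rN)) + y2 * (rc * rb / rN) + y3 * (- ra * rb / rN))"
        using N0 by (simp add: algebra_simps)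
    qed
    \<comment> \<open>Here E has its 1 at (2, 1), so the pairing reads off the entry at (1,
      2).\<close>
    have "order_coords 0 (- rb1 * ra / rN) (- ra * rb / rN) (2 * ra * ra / rN) (1 - 2 * ra * rc / rN)"
    proof -
      have "anticomm (- ra * rb / rN) (2 * ra * ra / rN) (1 - 2 * ra * rc / rN)"
        using Nd unfolding anticomm_def by (simp add: N0i field_simps, Groebner_Basis.algebra?)
      moreover have
        "0 - rb * (- rb1 * ra / rN) + rb1 * (- ra * rb / rN) = 0"
        "2 * ra * (- rb1 * ra / rN) + rb1 * (2 * ra * ra / rN) = 0"
        "- 2 * rc * (- rb1 * ra / rN) + rb1 * (1 - 2 * ra * rc / rN) = rb1"
        "0 + rb * (- rb1 * ra / rN) - rb1 * (- ra * rb / rN) = 0"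
        using N0 by (simp_all add: field_simps)
      moreover have "2 * (rb * (- ra * rb / rN) + 2 * rc * (2 * ra * ra / rN)) = 2 * ra"
        using Nd by (simp add: N0i field_simps, Groebner_Basis.algebra?)
      moreover have "2 * (2 * ra * (- ra * rb / rN) + rb * (2 * ra * ra / rN)) = 0"
        using Nd by (simp add: N0i field_simps, Groebner_Basis.algebra?)
      moreover have "2 * (2 * rc * (- ra * rb / rN) - rb * (1 - 2 * ra * rc / rN)) = - 2 * rb"
        using Nd by (simp add: N0i field_simps, Groebner_Basis.algebra?)
      ultimately show ?thesis
        by (simp only: order_coords_def Ints_0 Ints_of_int Ints_mult Ints_numeral Ints_minus simp_thms)
    qed
    from pair[OF this]
    show "2 * ra * rb1 * x1 + rD * y2 \<in> \<int>"
    proof (rule Ints_eqI[rotated])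
      have "2 * y1 * (- ra * rb / rN) + y2 * (1 - 2 * ra * rc / rN) + y3 * (2 * ra * ra / rN)
         = y2 - 2 * ra / rN * (rb * y1 + rc * y2 - ra * y3)" using N0 by (simp add: field_simps)
      hence "2 * y1 * (- ra * rb / rN) + y2 * (1 - 2 * ra * rc / rN) + y3 * (2 * ra * ra / rN) = y2"
        using y' by simp
      thus "2 * ra * rb1 * x1 + rD * y2 = 2 * x0 * 0 - 2 * rN * x1 * (- rb1 * ra / rN)
        + rD * (2 * y1 * (- ra * rb / rN) + y2 * (1 - 2 * ra * rc / rN) + y3 * (2 * ra * ra / rN))"
        using N0 by (simp add: algebra_simps)
    qed
    \<comment> \<open>Here E has its 1 at (1, 2), so the pairing reads off the entry at (2,
      1).\<close>
    have "order_coords 0 (rb1 * rc / rN) (rb * rc / rN) (1 - 2 * ra * rc / rN) (2 * rc * rc / rN)"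
    proof -
      have "anticomm (rb * rc / rN) (1 - 2 * ra * rc / rN) (2 * rc * rc / rN)"
        using Nd unfolding anticomm_def by (simp add: N0i field_simps, Groebner_Basis.algebra?)
      moreover have
        "0 - rb * (rb1 * rc / rN) + rb1 * (rb * rc / rN) = 0"
        "2 * ra * (rb1 * rc / rN) + rb1 * (1 - 2 * ra * rc / rN) = rb1"
        "- 2 * rc * (rb1 * rc / rN) + rb1 * (2 * rc * rc / rN) = 0"
        "0 + rb * (rb1 * rc / rN) - rb1 * (rb * rc / rN) = 0"
        using N0 by (simp_all add: field_simps)
      moreover have "2 * (rb * (rb * rc / rN) + 2 * rc * (1 - 2 * ra * rc / rN)) = 2 * rc"
        using Nd by (simp add: N0i field_simps, Groebner_Basis.algebra?)
      moreover have "2 * (2 * ra * (rb * rc / rN) + rb * (1 - 2 * ra * rc / rN)) = 2 * rb"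
        using Nd by (simp add: N0i field_simps, Groebner_Basis.algebra?)
      moreover have "2 * (2 * rc * (rb * rc / rN) - rb * (2 * rc * rc / rN)) = 0"
        using Nd by (simp add: N0i field_simps, Groebner_Basis.algebra?)
      ultimately show ?thesis
        by (simp only: order_coords_def Ints_0 Ints_of_int Ints_mult Ints_numeral Ints_minus simp_thms)
    qed
    from pair[OF this]
    show "- 2 * rc * rb1 * x1 + rD * y3 \<in> \<int>"
    proof (rule Ints_eqI[rotated])
      have "2 * y1 * (rb * rc / rN) + y2 * (2 * rc * rc / rN) + y3 * (1 - 2 * ra * rc / rN)
         = y3 + 2 * rc / rN * (rb * y1 + rc * y2 - ra * y3)" using N0 by (simp add: field_simps)
      hence "2 * y1 * (rb * rc / rN) + y2 * (2 * rc * rc / rN) + y3 * (1 - 2 * ra * rc / rN) = y3"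
        using y' by simp
      thus "- 2 * rc * rb1 * x1 + rD * y3 = 2 * x0 * 0 - 2 * rN * x1 * (rb1 * rc / rN)
        + rD * (2 * y1 * (rb * rc / rN) + y2 * (2 * rc * rc / rN) + y3 * (1 - 2 * ra * rc / rN))"
        using N0 by (simp add: algebra_simps)
    qed
    have "det (mk x0 x1 y1 y2 y3) \<in> \<int>" by (rule is_order_det_Ints[OF O(1) Rz_is_order det_Rz M])
    thus "x0\<^sup>2 + rN * x1\<^sup>2 - rD * (y1\<^sup>2 + y2 * y3) \<in> \<int>" unfolding det_mk[OF y] of_real_in_Ints_iff .
  qed
qed

lemma Rz_is_maximal_order: "is_maximal_order (Bz zz) (Rz zz)"
  unfolding is_maximal_order_def
proof (intro conjI allI impI Rz_is_order)
  fix Ord assume "is_order (Bz zz) Ord \<and> Rz zz \<subseteq> Ord"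
  hence O: "is_order (Bz zz) Ord" "Rz zz \<subseteq> Ord" by auto
  have "M \<in> Rz zz" if "M \<in> Ord" for M
  proof -
    have "M \<in> Bz zz" using that O(1) by (auto simp: is_order_def)
    then obtain x0 x1 y1 y2 y3 where "anticomm y1 y2 y3" "M = mk x0 x1 y1 y2 y3" using Bz_zz by blast
    thus ?thesis using order_coords_of_order_above[OF O] that Rz_zz by blast
  qed
  thus "Ord = Rz zz" using O(2) by blast
qed

section \<open>Standard generators of the quaternion algebra\<close>

lemma Bz_quat_alg_iso: "quat_alg_iso (Bz zz) (- N) D"
proof -
  \<comment> \<open>\<open>I\<close> is A. For \<open>J\<close> the choice y1 = 1, y2 = 0 makes the
    square of Y equal to 1, and \<open>anticomm\<close> then dictates y3 = b / a.\<close>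
  define I J where "I = mk 0 1 0 0 0" and "J = mk 0 0 1 0 (rb / ra)"
  have a0: "ra \<noteq> 0" using pos_facts by auto
  have IJ: "I ** J = mk 0 0 rb (- 2 * ra) ((rb * rb - 2 * ra * rc) / ra)"
    using a0 by (simp add: I_def J_def mk_def mat2_eq_iff matrix_mult_2_nth complex_eq_iff field_simps)
  have "I ** I = mat (of_int (- N))"
    by (simp add: I_def mk_def mat2_eq_iff matrix_mult_2_nth mat_def complex_eq_iff real_form_disc power2_eq_square)
  moreover have "J ** J = mat (of_int D)"
    using a0 s_sq by (simp add: J_def mk_def mat2_eq_iff matrix_mult_2_nth mat_def complex_eq_iff)
  moreover have "I ** J = - (J ** I)"
    unfolding IJ using a0 by (simp add: I_def J_def mk_def mat2_eq_iff matrix_mult_2_nth complex_eq_iff field_simps)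
  moreover have comb: "cscale (of_real q0) (mat 1) + cscale (of_real q1) I + cscale (of_real q2) J + cscale (of_real q3) (I ** J)
     = mk q0 q1 (q2 + q3 * rb) (- 2 * q3 * ra) ((q2 * rb + q3 * (rb * rb - 2 * ra * rc)) / ra)" for q0 q1 q2 q3
    unfolding mk_one[symmetric] IJ unfolding I_def J_def mk_scale mk_add
    by (simp add: add_divide_distrib mult.commute mult.left_commute)
  have "Bz zz = {cscale q0 (mat 1) + cscale q1 I + cscale q2 J + cscale q3 (I ** J) | q0 q1 q2 q3.
             q0 \<in> \<rat> \<and> q1 \<in> \<rat> \<and> q2 \<in> \<rat> \<and> q3 \<in> \<rat>}" (is "_ = ?S")
  proof (intro equalityI subsetI)
    fix M assume "M \<in> Bz zz"
    then obtain x0 x1 y1 y2 y3 where x: "anticomm y1 y2 y3" "x0 \<in> \<rat>" "x1 \<in> \<rat>" "y1 \<in> \<rat>" "y2 \<in> \<rat>" "y3 \<in> \<rat>"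
      and M: "M = mk x0 x1 y1 y2 y3" using Bz_zz by blast
    \<comment> \<open>Among the four basis elements only I J has a nonzero y2, so y2 determines q3,
      and y1 then determines q2.\<close>
    define q3 where "q3 = - y2 / (2 * ra)"
    define q2 where "q2 = y1 - q3 * rb"
    have q: "q2 \<in> \<rat>" "q3 \<in> \<rat>" using x by (simp_all add: q2_def q3_def)
    have y: "y1 = q2 + q3 * rb" "y2 = - 2 * q3 * ra" using a0 by (simp_all add: q2_def q3_def)
    moreover have "y3 = (q2 * rb + q3 * (rb * rb - 2 * ra * rc)) / ra"
      using x(1) unfolding anticomm_iff y by (simp add: algebra_simps)
    ultimately have "M = cscale (of_real x0) (mat 1) + cscale (of_real x1) I + cscale (of_real q2) J + cscale (of_real q3) (I ** J)"
      unfolding M comb by simp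
    thus "M \<in> ?S" using q x by (metis (mono_tags, lifting) mem_Collect_eq Rats_complex_of_real_iff)
  next
    fix M assume "M \<in> ?S"
    then obtain q0 q1 q2 q3 where q: "q0 \<in> \<rat>" "q1 \<in> \<rat>" "q2 \<in> \<rat>" "q3 \<in> \<rat>"
      and M: "M = cscale q0 (mat 1) + cscale q1 I + cscale q2 J + cscale q3 (I ** J)" by blast
    have real: "\<exists>\<rho>. \<rho> \<in> \<rat> \<and> x = complex_of_real \<rho>" if "x \<in> \<rat>" for x
      using that by (metis Rats_cases of_rat_complex_of_real)
    obtain r0 r1 r2 r3 where r: "r0 \<in> \<rat>" "r1 \<in> \<rat>" "r2 \<in> \<rat>" "r3 \<in> \<rat>" "q0 = of_real r0" "q1 = of_real r1"
      "q2 = of_real r2" "q3 = of_real r3" using q real by metis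
    have M': "M = mk r0 r1 (r2 + r3 * rb) (- 2 * r3 * ra) ((r2 * rb + r3 * (rb * rb - 2 * ra * rc)) / ra)"
      unfolding M r(5-8) comb ..
    have "anticomm (r2 + r3 * rb) (- 2 * r3 * ra) ((r2 * rb + r3 * (rb * rb - 2 * ra * rc)) / ra)"
      unfolding anticomm_iff by (simp add: algebra_simps)
    moreover have "r2 + r3 * rb \<in> \<rat>" "- 2 * r3 * ra \<in> \<rat>" "(r2 * rb + r3 * (rb * rb - 2 * ra * rc)) / ra \<in> \<rat>"
      using r by simp_all
    ultimately show "M \<in> Bz zz" unfolding Bz_zz M' using r(1,2) by blast
  qed
  ultimately show ?thesis unfolding quat_alg_iso_def by blast
qed

end

subsection \<open>Ideals of the quadratic field\<close>

lemma of_int_in_OK: "of_int k \<in> OK D"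
  unfolding OK_def by (intro CollectI exI[of _ k] exI[of _ 0]) simp

lemma theta_in_OK: "(of_int D + sqrtD D) / 2 \<in> OK D"
  unfolding OK_def by (intro CollectI exI[of _ 0] exI[of _ 1]) simp

lemma sqrtD_in_OK: "sqrtD D \<in> OK D"
proof -
  have "sqrtD D = of_int (- D) + of_int 2 * ((of_int D + sqrtD D) / 2)" by (simp add: field_simps)
  thus ?thesis unfolding OK_def by blast
qed

lemma sqrtD_sq: "D < 0 \<Longrightarrow> sqrtD D * sqrtD D = of_int D"
  by (simp add: sqrtD_def complex_eq_iff)

lemma is_idealD:
  assumes "is_ideal D I"
  shows "I \<subseteq> OK D" "0 \<in> I" "\<And>x y. x \<in> I \<Longrightarrow> y \<in> I \<Longrightarrow> x + y \<in> I" "\<And>x. x \<in> I \<Longrightarrow> - x \<in> I"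
    "\<And>r x. r \<in> OK D \<Longrightarrow> x \<in> I \<Longrightarrow> r * x \<in> I"
  using assms by (auto simp: is_ideal_def)

lemma ideal_prod_mult_closed:
  assumes "is_ideal D A" "r \<in> OK D" "x \<in> ideal_prod A B"
  shows "r * x \<in> ideal_prod A B"
proof -
  obtain ps where ps: "x = sum_list (map (\<lambda>(a, b). a * b) ps)" "set ps \<subseteq> A \<times> B"
    using assms(3) by (auto simp: ideal_prod_def)
  have "r * sum_list (map (\<lambda>(a, b). a * b) qs) = sum_list (map (\<lambda>(a, b). a * b) (map (\<lambda>(a, b). (r * a, b)) qs))" for qs
    by (induction qs) (auto simp: algebra_simps)
  moreover have "set (map (\<lambda>(a, b). (r * a, b)) ps) \<subseteq> A \<times> B"
    using ps(2) is_idealD(5)[OF assms(1,2)] by auto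
  ultimately show ?thesis unfolding ideal_prod_def ps(1) by blast
qed

lemma ideal_prod_subset:
  assumes "is_ideal D P" "is_ideal D Q"
  shows "ideal_prod P Q \<subseteq> P \<inter> Q"
proof
  fix x assume "x \<in> ideal_prod P Q"
  then obtain ps where ps: "x = sum_list (map (\<lambda>(a, b). a * b) ps)" "set ps \<subseteq> P \<times> Q"
    by (auto simp: ideal_prod_def)
  have "sum_list (map (\<lambda>(a, b). a * b) qs) \<in> P \<inter> Q" if "set qs \<subseteq> P \<times> Q" for qs
    using that
  proof (induction qs)
    case Nil
    show ?case using is_idealD(2) assms by auto
  next
    case (Cons p qs)
    obtain u v where p: "p = (u, v)" by (cases p)
    have uv: "u \<in> P" "v \<in> Q" using Cons.prems p by auto
    hence "v * u \<in> P" "u * v \<in> Q" using assms is_idealD(1,5) by blast+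
    hence "u * v \<in> P \<inter> Q" by (simp add: mult.commute)
    thus ?case using Cons p is_idealD(3)[OF assms(1)] is_idealD(3)[OF assms(2)] by auto
  qed
  thus "x \<in> P \<inter> Q" using ps by blast
qed

text \<open>Twice an element of P is an integer plus a multiple of sqrt D. That integer lies in P,
  so D divides it, as otherwise P would contain 1; hence it lies in Q. Since D is odd, x is a
  combination of D x and 2 x, both in Q. By symmetry only one proper ideal contains sqrt D.\<close>

lemma ideal_above_ramified_prime_subset:
  assumes D: "D < 0" "prime (- D)" "odd D"
    and P: "is_ideal D P" "P \<noteq> OK D" "sqrtD D \<in> P" and Q: "is_ideal D Q" "sqrtD D \<in> Q"
  shows "P \<subseteq> Q"
proof
  fix x assume x: "x \<in> P"
  have xO: "x \<in> OK D" using x is_idealD(1)[OF P(1)] by blast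
  then obtain u v where uv: "x = of_int u + of_int v * ((of_int D + sqrtD D) / 2)" by (auto simp: OK_def)
  define n where "n = 2 * u + v * D"
  have n: "of_int n = of_int 2 * x + of_int (- v) * sqrtD D" by (simp add: uv n_def algebra_simps)
  have nP: "of_int n \<in> P" unfolding n
    by (intro is_idealD(3,5)[OF P(1)] of_int_in_OK x P(3))
  have DI: "of_int D * y \<in> I" if "y \<in> OK D" "is_ideal D I" "sqrtD D \<in> I" for y I
  proof -
    have "sqrtD D * (y * sqrtD D) \<in> I" using is_idealD(5)[OF that(2)] that sqrtD_in_OK by blast
    thus ?thesis using sqrtD_sq[OF D(1)] by (simp add: mult.assoc mult.commute mult.left_commute)
  qed
  have "D dvd n"
  proof (rule ccontr)
    assume "\<not> D dvd n"
    hence "coprime (- D) n" using D(2) by (intro prime_imp_coprime) auto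
    hence "coprime n D" by (simp add: coprime_commute)
    then obtain \<alpha> \<beta> where "\<alpha> * n + \<beta> * D = 1" by (metis bezout_int coprime_iff_gcd_eq_1)
    from arg_cong[OF this, of complex_of_int]
    have e: "1 = of_int \<alpha> * of_int n + of_int D * complex_of_int \<beta>" by (simp add: mult.commute)
    have one: "1 \<in> P" by (subst e) (intro is_idealD(3,5)[OF P(1)] of_int_in_OK nP DI P)
    have "OK D \<subseteq> P" using is_idealD(5)[OF P(1) _ one] by fastforce
    thus False using P(2) is_idealD(1)[OF P(1)] by blast
  qed
  then obtain k where k: "n = D * k" by (elim dvdE)
  obtain j where j: "D = 2 * j + 1" using D(3) by (elim oddE)
  have nQ: "of_int n \<in> Q" using DI[OF of_int_in_OK[of k] Q] by (simp add: k)
  have "of_int 2 * x = of_int n + of_int v * sqrtD D" using n by simp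
  also have "\<dots> \<in> Q" by (intro is_idealD(3,5)[OF Q(1)] of_int_in_OK nQ Q(2))
  finally have x2: "of_int 2 * x \<in> Q" .
  have "x = of_int D * x + of_int (- j) * (of_int 2 * x)"
    using arg_cong[OF j, of complex_of_int] by (simp add: algebra_simps)
  also have "\<dots> \<in> Q" by (intro is_idealD(3)[OF Q(1)] DI xO Q is_idealD(5)[OF Q(1) of_int_in_OK x2])
  finally show "x \<in> Q" .
qed

text \<open>If N were -D, both primes would contain D, hence its root sqrt D, and would therefore
  coincide.\<close>

lemma splits_imp_ne_ramified:
  assumes D: "D < 0" "prime (- D)" "odd D" and "splits D N"
  shows "N \<noteq> - D"
proof
  assume N: "N = - D"
  obtain P Q where PQ: "is_prime_ideal D P" "is_prime_ideal D Q" "P \<noteq> Q"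
    "ideal_prod P Q = (\<lambda>x. of_int N * x) ` OK D"
    using assms(4) by (auto simp: splits_def)
  have id: "is_ideal D P" "is_ideal D Q" "P \<noteq> OK D" "Q \<noteq> OK D" using PQ by (auto simp: is_prime_ideal_def)
  have "complex_of_int D = of_int N * of_int (- 1)" by (simp add: N)
  hence "of_int D \<in> ideal_prod P Q" unfolding PQ(4) using of_int_in_OK by blast
  hence "sqrtD D * sqrtD D \<in> P \<inter> Q" using ideal_prod_subset[OF id(1,2)] sqrtD_sq[OF D(1)] by auto
  hence "sqrtD D \<in> P" "sqrtD D \<in> Q" using PQ(1,2) sqrtD_in_OK unfolding is_prime_ideal_def by blast+
  hence "P = Q" using ideal_above_ramified_prime_subset[OF D] id by blast
  thus False using PQ(3) by blast
qed

text \<open>The lattice is stable under (D + sqrt D) / 2. For its action on the second basis vector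
  the imaginary parts give n = (D - b1) / 2, and the real parts then give the divisibility.\<close>

lemma ideal_basis_discriminant:
  fixes D a1 b1 N :: int
  assumes D: "D < 0"
    and cl: "\<And>r x. r \<in> OK D \<Longrightarrow> x \<in> L \<Longrightarrow> r * x \<in> L"
    and L: "L = Zlattice2 (of_int (a1 * N)) ((- of_int b1 + sqrtD D) / 2)"
  shows "\<exists>c1. b1\<^sup>2 - D = 4 * a1 * N * c1"
proof -
  define s where "s = sqrt (- real_of_int D)"
  have s: "s > 0" "s * s = - real_of_int D" using D by (simp_all add: s_def)
  have sD: "sqrtD D = Complex 0 s" by (simp add: sqrtD_def s_def)
  let ?th = "(of_int D + sqrtD D) / 2" and ?om = "(- of_int b1 + sqrtD D) / 2"
  have "?om \<in> L" unfolding L Zlattice2_def by (intro CollectI exI[of _ 0] exI[of _ 1]) simp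
  hence "?th * ?om \<in> L" by (rule cl[OF theta_in_OK])
  then obtain m n where e: "?th * ?om = of_int m * of_int (a1 * N) + of_int n * ?om"
    unfolding L Zlattice2_def by blast
  have "(of_int D - of_int b1) * s = 2 * of_int n * s"
    using arg_cong[OF e, of Im] by (simp add: sD algebra_simps)
  hence n: "2 * real_of_int n = of_int D - of_int b1" using s(1) by simp
  have "- of_int D * of_int b1 + real_of_int D = 4 * of_int m * of_int (a1 * N) - 2 * of_int n * of_int b1"
    using arg_cong[OF e, of Re] s(2) by (simp add: sD field_simps)
  hence "real_of_int (b1\<^sup>2 - D) = of_int (4 * a1 * N * (- m))"
    unfolding n by (simp add: algebra_simps power2_eq_square)
  hence "b1\<^sup>2 - D = 4 * a1 * N * (- m)" by (simp only: of_int_eq_iff)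
  thus ?thesis by blast
qed

text \<open>A discriminant is 0 or 1 modulo 4, and a prime is not divisible by 4; in particular 2 is
  excluded.\<close>

lemma imag_quad_disc_odd_prime:
  assumes "imag_quad_disc (- p)" "prime p"
  shows "p mod 4 = 3"
proof -
  have "\<not> 4 dvd p"
  proof
    assume "4 dvd p"
    hence "2 * 2 dvd p" by simp
    then obtain k where "p = 2 * (2 * k)" by (elim dvdE) simp
    hence "is_unit (2::int) \<or> is_unit (2 * k)"
      using assms(2) by (metis irreducibleD prime_elem_imp_irreducible prime_imp_prime_elem)
    hence "is_unit (2::int)" by (metis is_unit_mult_iff)
    thus False by simp
  qed
  moreover have "(- p) mod 4 = 1 \<or> (- p) mod 4 = 0" using assms(1) by (auto simp: imag_quad_disc_def)
  ultimately show ?thesis by presburger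
qed

theorem mainTheorem13:
  fixes D N :: int and \<NN> \<aa> :: "complex set" and a1 b1 qa qb qc :: int
  assumes "D < -4" and "imag_quad_disc D" and "prime \<bar>D\<bar>"
    and "prime N" and "splits D N" and "imag_quad_disc (- N)"
    and "is_prime_ideal D \<NN>" and "ideal_norm D \<NN> = nat N"
    and "is_ideal D \<aa>" and "primitive_ideal D \<aa>" and "coprime (int (ideal_norm D \<aa>)) N"
    and "a1 > 0"
    and "ideal_prod \<aa> (cnj ` \<NN>) = Zlattice2 (of_int (a1 * N)) ((- of_int b1 + sqrtD D) / 2)"
    and "prim_pos_def_form qa qb qc" and "qb^2 - 4*qa*qc = - N"
  shows "let \<tau> = (- of_int b1 + sqrtD D) / (2 * of_int a1 * of_int N);
             z = cscale \<tau> (form_mat qa qb qc)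
         in (\<exists>a b. ramified_exactly_inf_and \<bar>D\<bar> a b \<and> quat_alg_iso (Bz z) a b)
            \<and> is_maximal_order (Bz z) (Rz z)"
proof -
  have D: "D < 0" "\<bar>D\<bar> = - D" "prime (- D)" using assms(1,3) by auto
  have D4: "- D mod 4 = 3" using imag_quad_disc_odd_prime[of "- D"] assms(2) D(3) by simp
  have N4: "N mod 4 = 3" using imag_quad_disc_odd_prime assms(4,6) by blast
  have N0: "N > 0" using assms(4) prime_gt_0_int by blast
  have oddD: "odd D" and oddN: "odd N" using D4 N4 by presburger+
  have "N \<noteq> - D" using splits_imp_ne_ramified[OF D(1,3) oddD assms(5)] .
  hence ND: "\<not> N dvd D" "\<not> - D dvd N"
    using primes_dvd_imp_eq[OF assms(4) D(3)] primes_dvd_imp_eq[OF D(3) assms(4)] by auto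
  obtain c1 where b1: "b1\<^sup>2 - D = 4 * a1 * N * c1"
    using ideal_basis_discriminant[OF D(1) ideal_prod_mult_closed[OF assms(9)] assms(13)] by blast
  hence Nb1: "N dvd b1\<^sup>2 - D" by simp
  have cop: "coprime D (2 * N)"
  proof -
    have "coprime (- D) N" using D(3) ND(2) by (rule prime_imp_coprime)
    thus ?thesis using oddD by simp
  qed
  interpret form_pair D N qa qb qc a1 b1 c1
  proof
    show "qa > 0" using assms(14) by (simp add: prim_pos_def_form_def)
    show "N = 4 * qa * qc - qb\<^sup>2" using assms(15) by simp
    show "D dvd x \<and> D dvd w" if "D dvd N * x\<^sup>2 + w\<^sup>2" for x w
      using norm_form_anisotropic_mod[OF D(1,3) D4 assms(4) N4 ND(1) Nb1 that] .
  qed (use D(1,3) cop N0 oddN assms(12) b1 in auto)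
  have "ramified_exactly_inf_and \<bar>D\<bar> (- N) D"
    unfolding D(2) by (rule ramified_exactly_inf_and_disc[OF D(1,3) D4 assms(4) N4 ND(1) Nb1])
  thus ?thesis
    using Bz_quat_alg_iso Rz_is_maximal_order unfolding zz_def tau_eq Let_def by blast
qed

end
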